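(* Let $f:(\mathbb{R}^n\setminus\mathcal{C})\times U\to\mathbb{R}^n$ be continuous and such that for every pair of compact sets $\mathcal{K}\subset\mathbb{R}^n\setminus\mathcal{C}$, $U_1\subset U$, there is some constant $L>0$ with $|f(x,u)-f(y,u)|\le L|x-y|$ for all $x,y\in\mathcal{K}$ and $u\in U_1$. Then the system $\dot x=f(x,u)$, $u\in U$, is GAC to $\mathcal{C}$ if and only if it is GAC to $\mathcal{C}$ with $U\cap\sigma$ controls for some continuous function $\sigma:(0,+\infty)\to(0,+\infty)$.
   Context: Standing setting. $\mathcal{C}\subset\mathbb{R}^n$ is a nonempty closed set with compact boundary, $U\subseteq\mathbb{R}^m$ is a closed cone, and $\mathbf d(x):=\mathrm{dist}(x,\mathcal{C})$ is the Euclidean distance from $\mathcal{C}$. $\mathcal{KL}$ functions (descent rates): continuous $\beta:[0,+\infty)^2\to[0,+\infty)$ such that $\beta(0,t)=0$ and $\beta(\cdot,t)$ is strictly increasing and unbounded for each $t\ge0$; $\beta(r,\cdot)$ is strictly decreasing for each $r>0$; $\beta(r,t)\to0$ as $t\to+\infty$ for each $r\ge0$. Admissible pair for $(f,U)$: a pair $(x,u)$ for which there is $T_x\in(0,+\infty]$ such that $u\in L^\infty_{loc}([0,T_x),U)$ (essentially bounded on compact subsets), $x:[0,T_x)\to\mathbb{R}^n\setminus\mathcal{C}$ is locally absolutely continuous, $\dot x(t)=f(x(t),u(t))$ for a.e. $t\in[0,T_x)$, and, if $T_x<+\infty$, $\lim_{t\to T_x^-}\mathbf d(x(t))=0$. If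 $T_x<+\infty$, $x$ is extended to $[0,+\infty)$ by setting $x(t):=\bar z$ for $t\ge T_x$, where $\bar z\in\partial\mathcal{C}$ is an arbitrary point of the form $\bar z=\lim_i x(\tau_i)$ for some $\tau_i\uparrow T_x$. GAC. The system is globally asymptotically controllable (GAC) to $\mathcal{C}$ if there is $\beta\in\mathcal{KL}$ such that for every $z\in\mathbb{R}^n\setminus\mathcal{C}$ there is an admissible pair $(x,u)$ for $(f,U)$ with $x(0)=z$ and $\mathbf d(x(t))\le\beta(\mathbf d(z),t)$ for all $t\ge0$. GAC with $U\cap\sigma$ controls. Given a continuous $\sigma:(0,+\infty)\to(0,+\infty)$, the system is GAC to $\mathcal{C}$ with $U\cap\sigma$ controls if there is $\beta\in\mathcal{KL}$ such that for every $z\in\mathbb{R}^n\setminus\mathcal{C}$ there is an admissible pair $(x,u)$ for $(f,U)$ with $x(0)=z$, $\mathbf d(x(t))\le\beta(\mathbf d(z),t)$ for all $t\ge0$, and $|u(t)|\le\sigma(\mathbf d(x(t)))$ for a.e. $t\in[0,T_x)$. *)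

theory Defs
  imports "HOL-Analysis.Analysis"
begin

definition KL_function :: "(real \<Rightarrow> real \<Rightarrow> real) \<Rightarrow> bool" where
  "KL_function \<beta> \<longleftrightarrow>
     continuous_on ({0..} \<times> {0..}) (\<lambda>(r, t). \<beta> r t) \<and>
     (\<forall>r\<ge>0. \<forall>t\<ge>0. 0 \<le> \<beta> r t) \<and>
     (\<forall>t\<ge>0. \<beta> 0 t = 0 \<and> strict_mono_on {0..} (\<lambda>r. \<beta> r t) \<and>
            \<not> bdd_above ((\<lambda>r. \<beta> r t) ` {0..})) \<and>
     (\<forall>r>0. strict_antimono_on {0..} (\<beta> r)) \<and>
     (\<forall>r\<ge>0. (\<beta> r \<longlongrightarrow> 0) at_top)"

text \<open>
  Absolute continuity of a function (as opposed to that of a measure): \<open>P\<close> ranges over finite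
  families of non-overlapping subintervals of \<open>S\<close>, given by their pairs of endpoints.
\<close>

definition absolutely_continuous_on :: "real set \<Rightarrow> (real \<Rightarrow> 'a::real_normed_vector) \<Rightarrow> bool" where
  "absolutely_continuous_on S x \<longleftrightarrow>
     (\<forall>\<epsilon>>0. \<exists>\<delta>>0. \<forall>P. finite P \<longrightarrow>
        (\<forall>(a, b)\<in>P. a \<le> b \<and> {a..b} \<subseteq> S) \<longrightarrow>
        pairwise (\<lambda>(a, b) (c, d). disjnt {a<..<b} {c<..<d}) P \<longrightarrow>
        (\<Sum>(a, b)\<in>P. b - a) < \<delta> \<longrightarrow>
        (\<Sum>(a, b)\<in>P. norm (x b - x a)) < \<epsilon>)"

definition locally_absolutely_continuous_on ::
    "real set \<Rightarrow> (real \<Rightarrow> 'a::real_normed_vector) \<Rightarrow> bool" where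
  "locally_absolutely_continuous_on I x \<longleftrightarrow>
     (\<forall>a b. {a..b} \<subseteq> I \<longrightarrow> absolutely_continuous_on {a..b} x)"

definition Linf_loc :: "real set \<Rightarrow> 'b::euclidean_space set \<Rightarrow> (real \<Rightarrow> 'b) set" where
  "Linf_loc I U = {u. u \<in> borel_measurable (lebesgue_on I) \<and>
     (AE t in lebesgue_on I. u t \<in> U) \<and>
     (\<forall>K. compact K \<and> K \<subseteq> I \<longrightarrow> (\<exists>M. AE t in lebesgue_on K. norm (u t) \<le> M))}"

text \<open>The interval \<open>[0, T)\<close>, where \<open>T = \<infinity>\<close> is allowed.\<close>

definition time_domain :: "ereal \<Rightarrow> real set" where
  "time_domain T = {t. 0 \<le> t \<and> ereal t < T}"

text \<open>Only the values of \<open>x\<close> and \<open>u\<close> on \<open>[0, T)\<close> are relevant here.\<close>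

definition admissible_pair ::
    "'a::euclidean_space set \<Rightarrow> ('a \<Rightarrow> 'b::euclidean_space \<Rightarrow> 'a) \<Rightarrow> 'b set \<Rightarrow>
     ereal \<Rightarrow> (real \<Rightarrow> 'a) \<Rightarrow> (real \<Rightarrow> 'b) \<Rightarrow> bool" where
  "admissible_pair C f U T x u \<longleftrightarrow>
     0 < T \<and>
     u \<in> Linf_loc (time_domain T) U \<and>
     (\<forall>t\<in>time_domain T. x t \<notin> C) \<and>
     locally_absolutely_continuous_on (time_domain T) x \<and>
     (AE t in lebesgue_on (time_domain T).
        (x has_vector_derivative f (x t) (u t)) (at t within time_domain T)) \<and>
     (T < \<infinity> \<longrightarrow> ((\<lambda>t. infdist (x t) C) \<longlongrightarrow> 0) (at_left (real_of_ereal T)))"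

text \<open>
  The values of \<open>x\<close> on \<open>[T, \<infinity>)\<close> are the ones prescribed by the extension convention for
  trajectories with a finite \<open>T\<close>: constantly equal to a boundary point of \<open>C\<close> that is the limit
  of \<open>x\<close> along some sequence of times increasing to \<open>T\<close>.
\<close>

definition extended_beyond :: "'a::euclidean_space set \<Rightarrow> ereal \<Rightarrow> (real \<Rightarrow> 'a) \<Rightarrow> bool" where
  "extended_beyond C T x \<longleftrightarrow>
     (T < \<infinity> \<longrightarrow>
       (\<exists>zbar\<in>frontier C.
          (\<exists>\<tau>::nat \<Rightarrow> real. range \<tau> \<subseteq> time_domain T \<and> incseq \<tau> \<and>
             \<tau> \<longlonglongrightarrow> real_of_ereal T \<and> (\<lambda>i. x (\<tau> i)) \<longlonglongrightarrow> zbar) \<and>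
          (\<forall>t\<ge>real_of_ereal T. x t = zbar)))"

definition GAC ::
    "'a::euclidean_space set \<Rightarrow> ('a \<Rightarrow> 'b::euclidean_space \<Rightarrow> 'a) \<Rightarrow> 'b set \<Rightarrow> bool" where
  "GAC C f U \<longleftrightarrow>
     (\<exists>\<beta>. KL_function \<beta> \<and>
       (\<forall>z. z \<notin> C \<longrightarrow>
         (\<exists>T x u. admissible_pair C f U T x u \<and> extended_beyond C T x \<and>
            x 0 = z \<and> (\<forall>t\<ge>0. infdist (x t) C \<le> \<beta> (infdist z C) t))))"

definition GAC_controls ::
    "'a::euclidean_space set \<Rightarrow> ('a \<Rightarrow> 'b::euclidean_space \<Rightarrow> 'a) \<Rightarrow> 'b set \<Rightarrow>
     (real \<Rightarrow> real) \<Rightarrow> bool" where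
  "GAC_controls C f U \<sigma> \<longleftrightarrow>
     (\<exists>\<beta>. KL_function \<beta> \<and>
       (\<forall>z. z \<notin> C \<longrightarrow>
         (\<exists>T x u. admissible_pair C f U T x u \<and> extended_beyond C T x \<and>
            x 0 = z \<and> (\<forall>t\<ge>0. infdist (x t) C \<le> \<beta> (infdist z C) t) \<and>
            (AE t in lebesgue_on (time_domain T). norm (u t) \<le> \<sigma> (infdist (x t) C)))))"

end

theory Submission
  imports Defs
begin

text \<open>
  Only the passage to \<open>U \<inter> \<sigma>\<close> controls is nontrivial. The complement of \<open>C\<close> is split into the
  dyadic annuli \<open>2\<^sup>k \<le> d \<le> 2\<^sup>k\<^sup>+\<^sup>1\<close>, which are compact because the boundary of \<open>C\<close> is.
  From a point of the \<open>k\<close>-th annulus, the given trajectory is followed until its distance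
  first equals \<open>2\<^sup>k\<^sup>-\<^sup>1\<close>. Up to that time the control is essentially bounded, and by the Lipschitz
  condition the same control steers all nearby points below the level \<open>2\<^sup>k\<close> as well, at distances
  that stay above \<open>2\<^sup>k\<^sup>-\<^sup>2\<close>. By compactness, one bound \<open>M\<^sub>k\<close> on the controls and one bound
  \<open>\<Theta>\<^sub>k\<close> on the durations suffice for the whole annulus, while the distance never exceeds
  \<open>B\<^sub>k = \<beta>(2\<^sup>k\<^sup>+\<^sup>1, 0) + 2\<^sup>k\<close>, which tends to \<open>0\<close> as \<open>k\<close> tends to \<open>-\<infinity>\<close>. Concatenating such
  arcs, whose annuli have decreasing indices, gives a trajectory that approaches \<open>C\<close>. A given distance
  is compatible with only finitely many \<open>k\<close>, so a continuous \<open>\<sigma>\<close> dominates the relevant \<open>M\<^sub>k\<close>.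
  Since the time spent in each annulus is at most \<open>\<Theta>\<^sub>k\<close>, a descent rate of the form
  \<open>G (\<alpha>(r) e\<^sup>-\<^sup>t)\<close> is available.
\<close>

section \<open>Differentiation of indefinite integrals\<close>

text \<open>The obstacle is that the essential bound on a given control depends on the starting
  point in no controlled way, so it has to be made locally uniform before compactness can act on it.
  The controls are only measurable in time, so the perturbation argument takes place among
  Caratheodory solutions: an integral equation is solved, and its solution must be differentiated
  almost everywhere. Little of the original rate \<open>\<beta>\<close> survives the concatenation.
  Per annulus there remain only an overshoot and a duration, and the new rate has to be assembled
  from these two sequences however they behave. The exponential form of the rate turns the sum of
  the durations into a product of factors, one for each arc. An arc ends outside \<open>C\<close>,
  so the chain never stops. Infinitely many arcs may fit into a finite time, and then the
  accumulation point of the junction times is the time at which \<open>C\<close> is reached.\<close>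

text \<open>Vitali's theorem extracts countably many disjoint balls that cover \<open>S\<close> up
  to a null set, and finite partial unions control the measure of their union. The hypothesis thus
  concerns finite disjoint families only, which are what Henstock's lemma can estimate.\<close>

lemma Vitali_cball_outer_measure_le:
  fixes S :: "'a::euclidean_space set" and c :: "'i \<Rightarrow> 'a"
  assumes r: "\<And>i. i \<in> K \<Longrightarrow> 0 < r i"
    and S: "\<And>x d. x \<in> S \<Longrightarrow> 0 < d \<Longrightarrow> \<exists>i\<in>K. x \<in> cball (c i) (r i) \<and> r i < d"
    and bound: "\<And>J. finite J \<Longrightarrow> J \<subseteq> K \<Longrightarrow>
      pairwise (\<lambda>i j. disjnt (cball (c i) (r i)) (cball (c j) (r j))) J \<Longrightarrow>
      (\<Sum>i\<in>J. measure lebesgue (cball (c i) (r i))) \<le> e"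
  shows "\<exists>T. S \<subseteq> T \<and> T \<in> lmeasurable \<and> measure lebesgue T \<le> e"
proof -
  obtain D where D: "countable D" "D \<subseteq> K"
     "pairwise (\<lambda>i j. disjnt (cball (c i) (r i)) (cball (c j) (r j))) D"
     "negligible (S - (\<Union>i \<in> D. cball (c i) (r i)))"
    by (rule Vitali_covering_theorem_cballs[of K r S c]) (use r S in \<open>auto simp: Bex_def\<close>)
  let ?V = "\<Union>i\<in>D. cball (c i) (r i)"
  let ?T = "?V \<union> (S - ?V)"
  have le: "measure lebesgue (\<Union>i\<in>J. cball (c i) (r i)) \<le> e" if J: "J \<subseteq> D" "finite J" for J
  proof -
    have "measure lebesgue (\<Union>i\<in>J. cball (c i) (r i)) \<le> (\<Sum>i\<in>J. measure lebesgue (cball (c i) (r i)))"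
      by (rule measure_UNION_le) (use J in auto)
    also have "\<dots> \<le> e"
      using J D bound[of J] pairwise_subset[OF D(3) J(1)] by blast
    finally show ?thesis .
  qed
  have V: "?V \<in> lmeasurable" "measure lebesgue ?V \<le> e"
    using le by (auto intro!: fmeasurable_UN_bound[OF D(1)] measure_UN_bound[OF D(1)])
  have N: "S - ?V \<in> lmeasurable" "measure lebesgue (S - ?V) = 0"
    using D(4) negligible_imp_measurable negligible_imp_measure0 by blast+
  have "measure lebesgue ?T \<le> e"
    using measure_Un_le[OF fmeasurableD[OF V(1)] fmeasurableD[OF N(1)]] V(2) N(2) by linarith
  moreover have "?T \<in> lmeasurable"
    by (rule fmeasurable.Un[OF V(1) N(1)])
  ultimately show ?thesis
    by (intro exI[of _ ?T] conjI) auto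
qed

text \<open>Suppose that at \<open>t\<close> the increments over arbitrarily short intervals miss
  \<open>g t\<close> by a rate larger than \<open>k\<close>. Such intervals form a Vitali cover of
  the set of these \<open>t\<close>, and disjoint ones are a tagged partial division. Henstock's
  lemma makes their total error small, hence also their total length.\<close>

lemma indefinite_integral_has_vector_derivative_ae:
  fixes g :: "real \<Rightarrow> 'a::euclidean_space"
  assumes g: "g integrable_on {a..b}"
  shows "negligible {t\<in>{a<..<b}. \<not> ((\<lambda>s. integral {a..s} g) has_vector_derivative g t) (at t)}"
proof -
  define F where "F s = integral {a..s} g" for s
  \<comment> \<open>The tag \<open>t\<close> is an endpoint of \<open>I (t,h)\<close>, the right one
    if \<open>h\<close> is negative, so that both one-sided difference quotients are
    covered.\<close>
  define I where "I = (\<lambda>(t::real,h::real). {min t (t+h)..max t (t+h)})"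
  define bad where "bad k t h \<longleftrightarrow> k * \<bar>h\<bar> < norm (F (t+h) - F t - h *\<^sub>R g t)" for k t h
  define E where "E k = {t\<in>{a<..<b}. \<forall>d>0. \<exists>h. h \<noteq> 0 \<and> \<bar>h\<bar> < d \<and> bad k t h}" for k
  have int_eq: "norm (measure lborel (I (t,h)) *\<^sub>R g t - integral (I (t,h)) g) = norm (F (t+h) - F t - h *\<^sub>R g t)"
    if sub: "I (t,h) \<subseteq> {a..b}" for t h
  proof (cases "h \<ge> 0")
    case True
    then have "integral {a..t} g + integral {t..t+h} g = integral {a..t+h} g"
      using sub by (intro Henstock_Kurzweil_Integration.integral_combine integrable_on_subinterval[OF g]) (auto simp: I_def)
    then have "integral (I (t,h)) g = F (t+h) - F t"
      using True by (simp add: I_def F_def algebra_simps)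
    then show ?thesis
      using True by (simp add: I_def norm_minus_commute)
  next
    case False
    then have "integral {a..t+h} g + integral {t+h..t} g = integral {a..t} g"
      using sub by (intro Henstock_Kurzweil_Integration.integral_combine integrable_on_subinterval[OF g]) (auto simp: I_def)
    then have "integral (I (t,h)) g = F t - F (t+h)"
      using False by (simp add: I_def F_def eq_diff_eq add.commute)
    moreover have "measure lborel (I (t,h)) = - h"
      using False by (simp add: I_def)
    ultimately show ?thesis
      by (simp only:) (simp add: algebra_simps)
  qed
  have "negligible (E k)" if k: "k > 0" for k
    unfolding negligible_outer_le
  proof (intro allI impI)
    fix e :: real assume e: "e > 0"
    \<comment> \<open>The covering balls have length \<open>2 * \<bar>h\<bar>\<close>, while a bad
      interval contributes an error of at least \<open>k * \<bar>h\<bar>\<close>. The tolerance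
      \<open>e * k / 2\<close> therefore bounds the total length of the balls by
      \<open>e\<close>.\<close>
    obtain \<gamma> where \<gamma>: "gauge \<gamma>"
      and H: "\<And>p. p tagged_partial_division_of cbox a b \<Longrightarrow> \<gamma> fine p \<Longrightarrow>
             (\<Sum>(x,k)\<in>p. norm (measure lborel k *\<^sub>R g x - integral k g)) < e * k / 2"
      using Henstock_lemma[of g a b "e * k / 2"] g e k by (auto simp: cbox_interval)
    let ?K = "{(t,h). t \<in> {a<..<b} \<and> h \<noteq> 0 \<and> cball t \<bar>h\<bar> \<subseteq> \<gamma> t \<inter> {a..b} \<and> bad k t h}"
    have Isub: "I (t,h) \<subseteq> cball t \<bar>h\<bar>" for t h
      by (auto simp: I_def dist_real_def)
    show "\<exists>T. E k \<subseteq> T \<and> T \<in> lmeasurable \<and> measure lebesgue T \<le> e"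
    proof (rule Vitali_cball_outer_measure_le[where K = ?K and c = fst and r = "\<lambda>i. \<bar>snd i\<bar>"])
      show "\<And>i. i \<in> ?K \<Longrightarrow> 0 < \<bar>snd i\<bar>" by auto
      show "\<exists>i\<in>?K. x \<in> cball (fst i) \<bar>snd i\<bar> \<and> \<bar>snd i\<bar> < d" if x: "x \<in> E k" "0 < d" for x d
      proof -
        have "open (\<gamma> x \<inter> {a<..<b})" "x \<in> \<gamma> x \<inter> {a<..<b}"
          using \<gamma> x by (auto simp: gauge_def E_def)
        then obtain d' where d': "d' > 0" "cball x d' \<subseteq> \<gamma> x \<inter> {a<..<b}"
          by (meson open_contains_cball)
        obtain h where h: "h \<noteq> 0" "\<bar>h\<bar> < min d d'" "bad k x h"
          using x d' unfolding E_def by (smt (verit) mem_Collect_eq)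
        have "cball x \<bar>h\<bar> \<subseteq> \<gamma> x \<inter> {a<..<b}"
          using h d'(2) by (intro order_trans[OF subset_cball[of "\<bar>h\<bar>" d' x]]) auto
        then have "cball x \<bar>h\<bar> \<subseteq> \<gamma> x \<inter> {a..b}"
          by (metis (no_types) Int_mono greaterThanLessThan_subseteq_atLeastAtMost_iff order_refl order_trans)
        then have "(x,h) \<in> ?K"
          using h(1,3) x(1) unfolding E_def by blast
        with h show ?thesis by (intro bexI[of _ "(x,h)"]) auto
      qed
      fix J assume J: "finite J" "J \<subseteq> ?K"
         "pairwise (\<lambda>i j. disjnt (cball (fst i) \<bar>snd i\<bar>) (cball (fst j) \<bar>snd j\<bar>)) J"
      let ?p = "(\<lambda>i. (fst i, I i)) ` J"
      have dj: "disjnt (I i) (I j)" "fst i \<noteq> fst j" if "i \<in> J" "j \<in> J" "i \<noteq> j" for i j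
      proof -
        have "disjnt (cball (fst i) \<bar>snd i\<bar>) (cball (fst j) \<bar>snd j\<bar>)"
          using J(3) that by (auto simp: pairwise_def)
        moreover have "fst i \<in> cball (fst i) \<bar>snd i\<bar>" "fst j \<in> cball (fst j) \<bar>snd j\<bar>"
          by auto
        moreover have "I i \<subseteq> cball (fst i) \<bar>snd i\<bar>" "I j \<subseteq> cball (fst j) \<bar>snd j\<bar>"
          using Isub[of "fst i" "snd i"] Isub[of "fst j" "snd j"] by auto
        ultimately show "disjnt (I i) (I j)" "fst i \<noteq> fst j"
          unfolding disjnt_def by (blast, metis IntI empty_iff)
      qed
      have inj: "inj_on (\<lambda>i. (fst i, I i)) J"
        using dj(2) by (auto intro!: inj_onI)
      have "?p tagged_partial_division_of cbox a b"
        unfolding tagged_partial_division_of_def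
      proof (intro conjI allI impI)
        show "finite ?p" using J by auto
        fix x K assume xK: "(x, K) \<in> ?p"
        then obtain t h where th: "(t,h) \<in> J" "x = t" "K = I (t,h)" by auto
        then have "cball t \<bar>h\<bar> \<subseteq> {a..b}" using J by auto
        then show "K \<subseteq> cbox a b" using Isub[of t h] th by auto
        show "x \<in> K" using th by (auto simp: I_def)
        show "\<exists>a b. K = cbox a b" using th by (auto simp: I_def)
      next
        fix x1 K1 x2 K2 assume "(x1, K1) \<in> ?p \<and> (x2, K2) \<in> ?p \<and> (x1, K1) \<noteq> (x2, K2)"
        then have "disjnt K1 K2" using dj(1) by auto
        then show "interior K1 \<inter> interior K2 = {}"
          using interior_subset[of K1] interior_subset[of K2] unfolding disjnt_def by blast
      qed
      moreover have "\<gamma> fine ?p"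
        unfolding fine_def
      proof clarify
        fix t h assume "(t, h) \<in> J"
        then have "cball t \<bar>h\<bar> \<subseteq> \<gamma> t" using J(2) by auto
        with Isub[of t h] show "\<And>s. s \<in> I (t, h) \<Longrightarrow> s \<in> \<gamma> (fst (t, h))" by auto
      qed
      ultimately have "(\<Sum>(x,k)\<in>?p. norm (measure lborel k *\<^sub>R g x - integral k g)) < e * k / 2"
        by (rule H)
      then have small: "(\<Sum>i\<in>J. norm (measure lborel (I i) *\<^sub>R g (fst i) - integral (I i) g)) < e * k / 2"
        by (simp add: sum.reindex[OF inj] case_prod_unfold)
      have "k / 2 * (\<Sum>i\<in>J. measure lebesgue (cball (fst i) \<bar>snd i\<bar>)) = (\<Sum>i\<in>J. k * \<bar>snd i\<bar>)"
        by (simp add: sum_distrib_left cball_eq_atLeastAtMost)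
      also have "\<dots> \<le> (\<Sum>i\<in>J. norm (measure lborel (I i) *\<^sub>R g (fst i) - integral (I i) g))"
      proof (rule sum_mono)
        fix i assume i: "i \<in> J"
        obtain t h where th: "i = (t,h)" by fastforce
        have "bad k t h" "cball t \<bar>h\<bar> \<subseteq> {a..b}" using i th J by auto
        then show "k * \<bar>snd i\<bar> \<le> norm (measure lborel (I i) *\<^sub>R g (fst i) - integral (I i) g)"
          using int_eq[OF order_trans[OF Isub[of t h]]] th unfolding bad_def by simp
      qed
      finally have "k / 2 * (\<Sum>i\<in>J. measure lebesgue (cball (fst i) \<bar>snd i\<bar>)) < k / 2 * e"
        using small by (simp add: mult.commute)
      then show "(\<Sum>i\<in>J. measure lebesgue (cball (fst i) \<bar>snd i\<bar>)) \<le> e"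
        using k by (simp add: mult_less_cancel_left_pos)
    qed
  qed
  then have "negligible (\<Union>n::nat. E (inverse (real (Suc n))))"
    by (intro negligible_countable_Union) auto
  moreover have "{t\<in>{a<..<b}. \<not> (F has_vector_derivative g t) (at t)} \<subseteq> (\<Union>n::nat. E (inverse (real (Suc n))))"
  proof clarify
    fix t assume t: "t \<in> {a<..<b}" and nd: "\<not> (F has_vector_derivative g t) (at t)"
    then obtain e where e: "e > 0"
      "\<And>d. d > 0 \<Longrightarrow> \<exists>y. \<bar>y - t\<bar> < d \<and> e * \<bar>y - t\<bar> < norm (F y - F t - (y - t) *\<^sub>R g t)"
      unfolding has_vector_derivative_def has_derivative_at_alt
      by (auto simp: bounded_linear_scaleR_left not_le)
    obtain n where n: "inverse (real (Suc n)) < e"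
      using reals_Archimedean[OF e(1)] by blast
    have "\<exists>h. h \<noteq> 0 \<and> \<bar>h\<bar> < d \<and> bad (inverse (real (Suc n))) t h" if d: "d > 0" for d
    proof -
      obtain y where y: "\<bar>y - t\<bar> < d" "e * \<bar>y - t\<bar> < norm (F y - F t - (y - t) *\<^sub>R g t)"
        using e(2)[OF d] by blast
      have "inverse (real (Suc n)) * \<bar>y - t\<bar> \<le> e * \<bar>y - t\<bar>"
        using n by (intro mult_right_mono) auto
      with y show ?thesis
        by (intro exI[of _ "y - t"]) (auto simp: bad_def)
    qed
    then show "t \<in> (\<Union>n::nat. E (inverse (real (Suc n))))"
      using t by (auto simp: E_def)
  qed
  ultimately show ?thesis
    unfolding F_def by (rule negligible_subset)
qed

section \<open>Absolutely continuous functions\<close>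

lemma absolutely_continuous_onD:
  assumes "absolutely_continuous_on S x" "0 < e"
  obtains d where "0 < d"
    "\<And>P. finite P \<Longrightarrow> (\<And>a b. (a, b) \<in> P \<Longrightarrow> a \<le> b \<and> {a..b} \<subseteq> S) \<Longrightarrow>
      pairwise (\<lambda>(a, b) (c, d). disjnt {a<..<b} {c<..<d}) P \<Longrightarrow>
      (\<Sum>(a, b)\<in>P. b - a) < d \<Longrightarrow> (\<Sum>(a, b)\<in>P. norm (x b - x a)) < e"
  using assms unfolding absolutely_continuous_on_def by (metis (no_types, lifting) case_prodI2)

lemma absolutely_continuous_onI:
  assumes "\<And>e. 0 < e \<Longrightarrow> \<exists>d>0. \<forall>P. finite P \<longrightarrow> (\<forall>a b. (a, b) \<in> P \<longrightarrow> a \<le> b \<and> {a..b} \<subseteq> S) \<longrightarrow>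
      pairwise (\<lambda>(a, b) (c, d). disjnt {a<..<b} {c<..<d}) P \<longrightarrow>
      (\<Sum>(a, b)\<in>P. b - a) < d \<longrightarrow> (\<Sum>(a, b)\<in>P. norm (x b - x a)) < e"
  shows "absolutely_continuous_on S x"
  unfolding absolutely_continuous_on_def
proof (intro allI impI)
  fix e :: real assume "e > 0"
  from assms[OF this] obtain d where d: "d>0" "\<forall>P. finite P \<longrightarrow> (\<forall>a b. (a, b) \<in> P \<longrightarrow> a \<le> b \<and> {a..b} \<subseteq> S) \<longrightarrow>
      pairwise (\<lambda>(a, b) (c, d). disjnt {a<..<b} {c<..<d}) P \<longrightarrow>
      (\<Sum>(a, b)\<in>P. b - a) < d \<longrightarrow> (\<Sum>(a, b)\<in>P. norm (x b - x a)) < e" by blast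
  then show "\<exists>\<delta>>0. \<forall>P. finite P \<longrightarrow>
        (\<forall>(a, b)\<in>P. a \<le> b \<and> {a..b} \<subseteq> S) \<longrightarrow>
        pairwise (\<lambda>(a, b) (c, d). disjnt {a<..<b} {c<..<d}) P \<longrightarrow>
        (\<Sum>(a, b)\<in>P. b - a) < \<delta> \<longrightarrow>
        (\<Sum>(a, b)\<in>P. norm (x b - x a)) < e"
    by (intro exI[of _ d] conjI d(1) allI impI) (auto simp: Ball_def)
qed

lemma absolutely_continuous_on_subset:
  assumes "absolutely_continuous_on S x" "T \<subseteq> S"
  shows "absolutely_continuous_on T x"
proof (rule absolutely_continuous_onI)
  fix e :: real assume "e > 0"
  then obtain d where d: "d > 0"
    "\<And>P. finite P \<Longrightarrow> (\<And>a b. (a, b) \<in> P \<Longrightarrow> a \<le> b \<and> {a..b} \<subseteq> S) \<Longrightarrow>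
      pairwise (\<lambda>(a, b) (c, d). disjnt {a<..<b} {c<..<d}) P \<Longrightarrow>
      (\<Sum>(a, b)\<in>P. b - a) < d \<Longrightarrow> (\<Sum>(a, b)\<in>P. norm (x b - x a)) < e"
    using absolutely_continuous_onD[OF assms(1)] by metis
  show "\<exists>d>0. \<forall>P. finite P \<longrightarrow> (\<forall>a b. (a, b) \<in> P \<longrightarrow> a \<le> b \<and> {a..b} \<subseteq> T) \<longrightarrow>
      pairwise (\<lambda>(a, b) (c, d). disjnt {a<..<b} {c<..<d}) P \<longrightarrow>
      (\<Sum>(a, b)\<in>P. b - a) < d \<longrightarrow> (\<Sum>(a, b)\<in>P. norm (x b - x a)) < e"
    by (intro exI[of _ d] conjI d(1) allI impI, rule d(2)) (use assms(2) in blast)+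
qed

lemma absolutely_continuous_on_cong:
  assumes "absolutely_continuous_on S x" "\<And>t. t \<in> S \<Longrightarrow> y t = x t"
  shows "absolutely_continuous_on S y"
proof (rule absolutely_continuous_onI)
  fix e :: real assume "e > 0"
  then obtain d where d: "d > 0"
    "\<And>P. finite P \<Longrightarrow> (\<And>a b. (a, b) \<in> P \<Longrightarrow> a \<le> b \<and> {a..b} \<subseteq> S) \<Longrightarrow>
      pairwise (\<lambda>(a, b) (c, d). disjnt {a<..<b} {c<..<d}) P \<Longrightarrow>
      (\<Sum>(a, b)\<in>P. b - a) < d \<Longrightarrow> (\<Sum>(a, b)\<in>P. norm (x b - x a)) < e"
    using absolutely_continuous_onD[OF assms(1)] by metis
  have "(\<Sum>(a, b)\<in>P. norm (y b - y a)) = (\<Sum>(a, b)\<in>P. norm (x b - x a))"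
    if "\<forall>a b. (a, b) \<in> P \<longrightarrow> a \<le> b \<and> {a..b} \<subseteq> S" for P
  proof (intro sum.cong refl, clarify)
    fix a b assume "(a, b) \<in> P"
    then have "a \<in> S" "b \<in> S" using that by fastforce+
    then show "norm (y b - y a) = norm (x b - x a)" by (simp add: assms(2))
  qed
  with d show "\<exists>d>0. \<forall>P. finite P \<longrightarrow> (\<forall>a b. (a, b) \<in> P \<longrightarrow> a \<le> b \<and> {a..b} \<subseteq> S) \<longrightarrow>
      pairwise (\<lambda>(a, b) (c, d). disjnt {a<..<b} {c<..<d}) P \<longrightarrow>
      (\<Sum>(a, b)\<in>P. b - a) < d \<longrightarrow> (\<Sum>(a, b)\<in>P. norm (y b - y a)) < e"
    by (intro exI[of _ d]) auto
qed

lemma absolutely_continuous_on_add: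
  assumes "absolutely_continuous_on S x" "absolutely_continuous_on S y"
  shows "absolutely_continuous_on S (\<lambda>t. x t + y t)"
proof (rule absolutely_continuous_onI)
  fix e :: real assume e: "e > 0"
  obtain d where d: "d > 0"
    "\<And>P. finite P \<Longrightarrow> (\<And>a b. (a, b) \<in> P \<Longrightarrow> a \<le> b \<and> {a..b} \<subseteq> S) \<Longrightarrow>
      pairwise (\<lambda>(a, b) (c, d). disjnt {a<..<b} {c<..<d}) P \<Longrightarrow>
      (\<Sum>(a, b)\<in>P. b - a) < d \<Longrightarrow> (\<Sum>(a, b)\<in>P. norm (x b - x a)) < e/2"
    using absolutely_continuous_onD[OF assms(1), of "e/2"] e by (metis half_gt_zero)
  obtain d' where d': "d' > 0"
    "\<And>P. finite P \<Longrightarrow> (\<And>a b. (a, b) \<in> P \<Longrightarrow> a \<le> b \<and> {a..b} \<subseteq> S) \<Longrightarrow>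
      pairwise (\<lambda>(a, b) (c, d). disjnt {a<..<b} {c<..<d}) P \<Longrightarrow>
      (\<Sum>(a, b)\<in>P. b - a) < d' \<Longrightarrow> (\<Sum>(a, b)\<in>P. norm (y b - y a)) < e/2"
    using absolutely_continuous_onD[OF assms(2), of "e/2"] e by (metis half_gt_zero)
  have "(\<Sum>(a, b)\<in>P. norm (x b + y b - (x a + y a)))
      \<le> (\<Sum>(a, b)\<in>P. norm (x b - x a)) + (\<Sum>(a, b)\<in>P. norm (y b - y a))" for P
    unfolding sum.distrib[symmetric] case_prod_unfold
    by (intro sum_mono) (metis add_diff_add norm_triangle_ineq)
  moreover have "(\<Sum>(a, b)\<in>P. norm (x b - x a)) < e/2 \<and> (\<Sum>(a, b)\<in>P. norm (y b - y a)) < e/2"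
    if "finite P" "\<forall>a b. (a, b) \<in> P \<longrightarrow> a \<le> b \<and> {a..b} \<subseteq> S"
      "pairwise (\<lambda>(a, b) (c, d). disjnt {a<..<b} {c<..<d}) P" "(\<Sum>(a, b)\<in>P. b - a) < min d d'" for P
    using that by (intro conjI d(2) d'(2)) auto
  ultimately show "\<exists>d>0. \<forall>P. finite P \<longrightarrow> (\<forall>a b. (a, b) \<in> P \<longrightarrow> a \<le> b \<and> {a..b} \<subseteq> S) \<longrightarrow>
      pairwise (\<lambda>(a, b) (c, d). disjnt {a<..<b} {c<..<d}) P \<longrightarrow>
      (\<Sum>(a, b)\<in>P. b - a) < d \<longrightarrow> (\<Sum>(a, b)\<in>P. norm (x b + y b - (x a + y a))) < e"
    using d(1) d'(1) by (intro exI[of _ "min d d'"] conjI allI impI) (simp, smt (verit) field_sum_of_halves)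
qed

lemma lipschitz_imp_absolutely_continuous_on:
  assumes "\<And>s t. s \<in> S \<Longrightarrow> t \<in> S \<Longrightarrow> norm (x t - x s) \<le> L * \<bar>t - s\<bar>"
  shows "absolutely_continuous_on S x"
proof (rule absolutely_continuous_onI)
  fix e :: real assume e: "e > 0"
  define K where "K = max L 1"
  have K: "K > 0" "L \<le> K" by (auto simp: K_def)
  have "(\<Sum>(a, b)\<in>P. norm (x b - x a)) < e"
    if P: "\<forall>a b. (a, b) \<in> P \<longrightarrow> a \<le> b \<and> {a..b} \<subseteq> S" "(\<Sum>(a, b)\<in>P. b - a) < e / K" for P
  proof -
    have "(\<Sum>(a, b)\<in>P. norm (x b - x a)) \<le> (\<Sum>(a, b)\<in>P. K * (b - a))"
    proof (rule sum_mono, clarify)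
      fix a b assume ab: "(a, b) \<in> P"
      then have "a \<in> S" "b \<in> S" "a \<le> b" using P by fastforce+
      then show "norm (x b - x a) \<le> K * (b - a)"
        using assms[of a b] mult_right_mono[OF K(2), of "b - a"] by auto
    qed
    also have "\<dots> = K * (\<Sum>(a, b)\<in>P. b - a)" by (simp add: sum_distrib_left case_prod_unfold)
    also have "\<dots> < e" using P(2) K by (simp add: field_simps)
    finally show ?thesis .
  qed
  then show "\<exists>d>0. \<forall>P. finite P \<longrightarrow> (\<forall>a b. (a, b) \<in> P \<longrightarrow> a \<le> b \<and> {a..b} \<subseteq> S) \<longrightarrow>
      pairwise (\<lambda>(a, b) (c, d). disjnt {a<..<b} {c<..<d}) P \<longrightarrow>
      (\<Sum>(a, b)\<in>P. b - a) < d \<longrightarrow> (\<Sum>(a, b)\<in>P. norm (x b - x a)) < e"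
    using K e by (intro exI[of _ "e / K"]) auto
qed

lemma absolutely_continuous_on_imp_continuous_on:
  assumes "absolutely_continuous_on {a..b} x"
  shows "continuous_on {a..b} x"
  unfolding continuous_on_iff
proof (intro ballI allI impI)
  fix t e :: real assume t: "t \<in> {a..b}" and "e > 0"
  then obtain d where d: "d > 0"
    "\<And>P. finite P \<Longrightarrow> (\<And>c d. (c, d) \<in> P \<Longrightarrow> c \<le> d \<and> {c..d} \<subseteq> {a..b}) \<Longrightarrow>
      pairwise (\<lambda>(a, b) (c, d). disjnt {a<..<b} {c<..<d}) P \<Longrightarrow>
      (\<Sum>(a, b)\<in>P. b - a) < d \<Longrightarrow> (\<Sum>(a, b)\<in>P. norm (x b - x a)) < e"
    using absolutely_continuous_onD[OF assms] by metis
  show "\<exists>d>0. \<forall>s\<in>{a..b}. dist s t < d \<longrightarrow> dist (x s) (x t) < e"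
  proof (intro exI[of _ d] conjI ballI impI d(1))
    fix s assume s: "s \<in> {a..b}" "dist s t < d"
    have "(\<Sum>(a, b)\<in>{(min s t, max s t)}. norm (x b - x a)) < e"
    proof (rule d(2))
      show "(\<Sum>(a, b)\<in>{(min s t, max s t)}. b - a) < d"
        using s by (auto simp: dist_real_def)
    qed (use s t in auto)
    then show "dist (x s) (x t) < e"
      by (cases "s \<le> t") (simp_all add: dist_norm norm_minus_commute)
  qed
qed

lemma absolutely_continuous_on_translation:
  assumes "absolutely_continuous_on S x"
  shows "absolutely_continuous_on ((+) c ` S) (\<lambda>t. x (t - c))"
proof (rule absolutely_continuous_onI)
  fix e :: real assume e: "e > 0"
  then obtain d where d: "d > 0"
    "\<And>P. finite P \<Longrightarrow> (\<And>a b. (a, b) \<in> P \<Longrightarrow> a \<le> b \<and> {a..b} \<subseteq> S) \<Longrightarrow>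
      pairwise (\<lambda>(a, b) (c, d). disjnt {a<..<b} {c<..<d}) P \<Longrightarrow>
      (\<Sum>(a, b)\<in>P. b - a) < d \<Longrightarrow> (\<Sum>(a, b)\<in>P. norm (x b - x a)) < e"
    using absolutely_continuous_onD[OF assms] by metis
  let ?h = "\<lambda>(a, b). (a - c, b - c)"
  have inj: "inj_on ?h P" for P by (auto intro!: inj_onI)
  have "(\<Sum>(a, b)\<in>P. norm (x (b - c) - x (a - c))) < e"
    if P: "finite P" "\<forall>a b. (a, b) \<in> P \<longrightarrow> a \<le> b \<and> {a..b} \<subseteq> (+) c ` S"
      "pairwise (\<lambda>(a, b) (c, d). disjnt {a<..<b} {c<..<d}) P" "(\<Sum>(a, b)\<in>P. b - a) < d" for P
  proof -
    have "(\<Sum>(a, b)\<in>?h ` P. norm (x b - x a)) < e"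
    proof (rule d(2))
      show "finite (?h ` P)" using P by auto
      show "a \<le> b \<and> {a..b} \<subseteq> S" if "(a, b) \<in> ?h ` P" for a b
      proof -
        have ab: "(a + c, b + c) \<in> P" using that by auto
        then have "a + c \<le> b + c" "{a + c..b + c} \<subseteq> (+) c ` S" using P(2) by blast+
        moreover have "s \<in> S" if "s \<in> {a..b}" for s
        proof -
          have "s + c \<in> (+) c ` S" using \<open>{a + c..b + c} \<subseteq> (+) c ` S\<close> that by auto
          then show ?thesis by auto
        qed
        ultimately show ?thesis by auto
      qed
      have dj: "disjnt {a-c<..<b-c} {p-c<..<q-c}" if "disjnt {a<..<b} {p<..<q}" for a b p q
        unfolding disjnt_iff
      proof (intro allI notI)
        fix s assume "s \<in> {a-c<..<b-c} \<and> s \<in> {p-c<..<q-c}"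
        then have "s + c \<in> {a<..<b} \<and> s + c \<in> {p<..<q}" by auto
        with that show False unfolding disjnt_iff by blast
      qed
      show "pairwise (\<lambda>(a, b) (c, d). disjnt {a<..<b} {c<..<d}) (?h ` P)"
        unfolding pairwise_image
        by (rule pairwise_mono[OF P(3)]) (auto simp: dj)
      show "(\<Sum>(a, b)\<in>?h ` P. b - a) < d"
        unfolding sum.reindex[OF inj] using P(4) by (simp add: case_prod_unfold)
    qed
    then show ?thesis
      unfolding sum.reindex[OF inj] by (simp add: case_prod_unfold)
  qed
  with d(1) show "\<exists>d>0. \<forall>P. finite P \<longrightarrow> (\<forall>a b. (a, b) \<in> P \<longrightarrow> a \<le> b \<and> {a..b} \<subseteq> (+) c ` S) \<longrightarrow>
      pairwise (\<lambda>(a, b) (c, d). disjnt {a<..<b} {c<..<d}) P \<longrightarrow>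
      (\<Sum>(a, b)\<in>P. b - a) < d \<longrightarrow> (\<Sum>(a, b)\<in>P. norm (x (b - c) - x (a - c))) < e"
    by blast
qed

lemma absolutely_continuous_on_join:
  fixes x :: "real \<Rightarrow> 'a::real_normed_vector"
  assumes "absolutely_continuous_on {a..c} x" "absolutely_continuous_on {c..b} x"
  shows "absolutely_continuous_on {a..b} x"
proof (rule absolutely_continuous_onI)
  fix e :: real assume e: "e > 0"
  let ?good = "\<lambda>S P d. finite P \<and> (\<forall>a b. (a, b) \<in> P \<longrightarrow> a \<le> b \<and> {a..b} \<subseteq> S) \<and>
      pairwise (\<lambda>(a, b) (c, d). disjnt {a<..<b} {c<..<d}) P \<and> (\<Sum>(a, b)\<in>P. b - a) < d"
  obtain d1 where d1: "d1 > 0" "\<And>P. ?good {a..c} P d1 \<Longrightarrow> (\<Sum>(a, b)\<in>P. norm (x b - x a)) < e/2"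
    using absolutely_continuous_onD[OF assms(1), of "e/2"] e by (metis half_gt_zero)
  obtain d2 where d2: "d2 > 0" "\<And>P. ?good {c..b} P d2 \<Longrightarrow> (\<Sum>(a, b)\<in>P. norm (x b - x a)) < e/2"
    using absolutely_continuous_onD[OF assms(2), of "e/2"] e by (metis half_gt_zero)
  have "(\<Sum>(a, b)\<in>P. norm (x b - x a)) < e" if P: "?good {a..b} P (min d1 d2)" for P
  proof -
    \<comment> \<open>An interval across \<open>c\<close> is cut by clipping it to either side.
      Intervals on the wrong side would all be clipped to the point \<open>c\<close>, and degenerate
      ones may coincide after clipping as well. Both kinds are discarded so that the clipping maps
      are injective; their contribution to the sum is 0.\<close>
    let ?l = "\<lambda>(s, t). (min s c, min t c)" and ?r = "\<lambda>(s, t). (max s c, max t c)"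
    let ?L = "{p\<in>P. fst p < snd p \<and> fst p < c}" and ?R = "{p\<in>P. fst p < snd p \<and> c < snd p}"
    have fin: "finite ?L" "finite ?R" using P by auto
    have dj: "disjnt {fst p<..<snd p} {fst q<..<snd q}" if "p \<in> P" "q \<in> P" "p \<noteq> q" for p q
      using P that by (auto simp: pairwise_def case_prod_unfold)
    have no: "max (fst p) (fst q) \<ge> min (snd p) (snd q)" if "p \<in> P" "q \<in> P" "p \<noteq> q" for p q
    proof (rule ccontr)
      assume "\<not> ?thesis"
      then obtain m where "max (fst p) (fst q) < m" "m < min (snd p) (snd q)" by (meson dense not_le)
      with dj[OF that] show False by (auto simp: disjnt_iff)
    qed
    have injl: "inj_on ?l ?L"
    proof (rule inj_onI, rule ccontr)
      fix p q assume "p \<in> ?L" "q \<in> ?L" "?l p = ?l q" "p \<noteq> q"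
      then show False using no[of p q] by (auto simp: case_prod_unfold min_def max_def split: if_splits)
    qed
    have injr: "inj_on ?r ?R"
    proof (rule inj_onI, rule ccontr)
      fix p q assume "p \<in> ?R" "q \<in> ?R" "?r p = ?r q" "p \<noteq> q"
      then show False using no[of p q] by (auto simp: case_prod_unfold min_def max_def split: if_splits)
    qed
    have len: "(\<Sum>p\<in>Q. h p) \<le> (\<Sum>p\<in>P. snd p - fst p)"
      if "Q \<subseteq> P" "\<And>p. p \<in> Q \<Longrightarrow> h p \<le> snd p - fst p" for Q h
    proof -
      have "(\<Sum>p\<in>Q. h p) \<le> (\<Sum>p\<in>Q. snd p - fst p)" by (rule sum_mono) (rule that)
      also have "\<dots> \<le> (\<Sum>p\<in>P. snd p - fst p)" by (rule sum_mono2) (use P that in auto)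
      finally show ?thesis .
    qed
    have sub: "fst p \<le> snd p \<and> {fst p..snd p} \<subseteq> {a..b}" if "p \<in> P" for p
      using P that by (cases p) auto
    have "(\<Sum>(s, t)\<in>?l ` ?L. norm (x t - x s)) < e/2"
    proof (intro d1(2) conjI)
      show "finite (?l ` ?L)" using fin by simp
      show "\<forall>s t. (s, t) \<in> ?l ` ?L \<longrightarrow> s \<le> t \<and> {s..t} \<subseteq> {a..c}"
        using sub by fastforce
      show "pairwise (\<lambda>(a, b) (c, d). disjnt {a<..<b} {c<..<d}) (?l ` ?L)"
        unfolding pairwise_image pairwise_def using dj by (fastforce simp: disjnt_iff)
      have "(\<Sum>(s, t)\<in>?l ` ?L. t - s) \<le> (\<Sum>p\<in>P. snd p - fst p)"
        unfolding sum.reindex[OF injl] by (simp add: case_prod_unfold, rule len) (auto simp: min_def)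
      then show "(\<Sum>(s, t)\<in>?l ` ?L. t - s) < d1"
        using P by (simp add: case_prod_unfold)
    qed
    then have l: "(\<Sum>p\<in>?L. norm (x (min (snd p) c) - x (min (fst p) c))) < e/2"
      unfolding sum.reindex[OF injl] by (simp add: case_prod_unfold)
    have "(\<Sum>(s, t)\<in>?r ` ?R. norm (x t - x s)) < e/2"
    proof (intro d2(2) conjI)
      show "finite (?r ` ?R)" using fin by simp
      show "\<forall>s t. (s, t) \<in> ?r ` ?R \<longrightarrow> s \<le> t \<and> {s..t} \<subseteq> {c..b}"
        using sub by fastforce
      show "pairwise (\<lambda>(a, b) (c, d). disjnt {a<..<b} {c<..<d}) (?r ` ?R)"
        unfolding pairwise_image pairwise_def using dj by (fastforce simp: disjnt_iff)
      have "(\<Sum>(s, t)\<in>?r ` ?R. t - s) \<le> (\<Sum>p\<in>P. snd p - fst p)"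
        unfolding sum.reindex[OF injr] by (simp add: case_prod_unfold, rule len) (auto simp: max_def)
      then show "(\<Sum>(s, t)\<in>?r ` ?R. t - s) < d2"
        using P by (simp add: case_prod_unfold)
    qed
    then have r: "(\<Sum>p\<in>?R. norm (x (max (snd p) c) - x (max (fst p) c))) < e/2"
      unfolding sum.reindex[OF injr] by (simp add: case_prod_unfold)
    have "(\<Sum>(s, t)\<in>P. norm (x t - x s)) \<le>
        (\<Sum>p\<in>P. norm (x (min (snd p) c) - x (min (fst p) c)) + norm (x (max (snd p) c) - x (max (fst p) c)))"
      unfolding case_prod_unfold
    proof (rule sum_mono)
      fix p assume "p \<in> P"
      have "x (snd p) - x (fst p) = (x (min (snd p) c) - x (min (fst p) c)) + (x (max (snd p) c) - x (max (fst p) c))"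
        by (auto simp: min_def max_def)
      then show "norm (x (snd p) - x (fst p)) \<le>
          norm (x (min (snd p) c) - x (min (fst p) c)) + norm (x (max (snd p) c) - x (max (fst p) c))"
        by (metis norm_triangle_ineq)
    qed
    also have "\<dots> = (\<Sum>p\<in>P. norm (x (min (snd p) c) - x (min (fst p) c))) +
        (\<Sum>p\<in>P. norm (x (max (snd p) c) - x (max (fst p) c)))"
      by (rule sum.distrib)
    also have "(\<Sum>p\<in>P. norm (x (min (snd p) c) - x (min (fst p) c))) = (\<Sum>p\<in>?L. norm (x (min (snd p) c) - x (min (fst p) c)))"
    proof (rule sum.mono_neutral_right)
      show "\<forall>p\<in>P - ?L. norm (x (min (snd p) c) - x (min (fst p) c)) = 0"
      proof
        fix p assume "p \<in> P - ?L"
        then have "min (snd p) c = min (fst p) c" using sub[of p] by auto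
        then show "norm (x (min (snd p) c) - x (min (fst p) c)) = 0" by simp
      qed
    qed (use P in auto)
    also have "(\<Sum>p\<in>P. norm (x (max (snd p) c) - x (max (fst p) c))) = (\<Sum>p\<in>?R. norm (x (max (snd p) c) - x (max (fst p) c)))"
    proof (rule sum.mono_neutral_right)
      show "\<forall>p\<in>P - ?R. norm (x (max (snd p) c) - x (max (fst p) c)) = 0"
      proof
        fix p assume "p \<in> P - ?R"
        then have "max (snd p) c = max (fst p) c" using sub[of p] by auto
        then show "norm (x (max (snd p) c) - x (max (fst p) c)) = 0" by simp
      qed
    qed (use P in auto)
    also have "(\<Sum>p\<in>?L. norm (x (min (snd p) c) - x (min (fst p) c))) +
        (\<Sum>p\<in>?R. norm (x (max (snd p) c) - x (max (fst p) c))) < e"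
      using l r by linarith
    finally show ?thesis .
  qed
  then show "\<exists>d>0. \<forall>P. finite P \<longrightarrow> (\<forall>s t. (s, t) \<in> P \<longrightarrow> s \<le> t \<and> {s..t} \<subseteq> {a..b}) \<longrightarrow>
      pairwise (\<lambda>(a, b) (c, d). disjnt {a<..<b} {c<..<d}) P \<longrightarrow>
      (\<Sum>(a, b)\<in>P. b - a) < d \<longrightarrow> (\<Sum>(a, b)\<in>P. norm (x b - x a)) < e"
    using d1(1) d2(1) by (intro exI[of _ "min d1 d2"]) auto
qed

section \<open>Picard iteration\<close>

lemma has_integral_exp_scaled:
  fixes c :: real
  assumes "c \<noteq> 0" "a \<le> b"
  shows "((\<lambda>s. exp (c * s)) has_integral (exp (c * b) - exp (c * a)) / c) {a..b}"
proof -
  have "((\<lambda>s. exp (c * s)) has_integral (exp (c * b) / c - exp (c * a) / c)) {a..b}"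
    by (rule fundamental_theorem_of_calculus)
       (use assms in \<open>auto intro!: derivative_eq_intros simp flip: has_real_derivative_iff_has_vector_derivative\<close>)
  then show ?thesis by (simp add: diff_divide_distrib)
qed

text \<open>
  Measured with the weight \<open>exp (2 * L * t)\<close>, each iteration step contracts distances by a
  factor of 2, so no smallness of the time interval is needed.
\<close>

lemma Picard_iteration:
  fixes g :: "real \<Rightarrow> 'a::euclidean_space \<Rightarrow> 'a"
  assumes L: "L > 0"
    and lip: "\<And>s v w. s \<in> {0..\<tau>} \<Longrightarrow> norm (g s v - g s w) \<le> L * norm (v - w)"
    and zero: "\<And>s. s \<in> {0..\<tau>} \<Longrightarrow> g s 0 = 0"
    and meas: "\<And>w. continuous_on {0..\<tau>} w \<Longrightarrow> (\<lambda>s. g s (w s)) \<in> borel_measurable (lebesgue_on {0..\<tau>})"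
  obtains w where "continuous_on {0..\<tau>} w"
    "(\<lambda>s. g s (w s)) integrable_on {0..\<tau>}"
    "\<And>t. t \<in> {0..\<tau>} \<Longrightarrow> w t = \<delta> + integral {0..t} (\<lambda>s. g s (w s))"
    "\<And>t. t \<in> {0..\<tau>} \<Longrightarrow> norm (w t) \<le> 2 * norm \<delta> * exp (2 * L * t)"
proof -
  define \<Phi> where "\<Phi> w t = \<delta> + integral {0..t} (\<lambda>s. g s (w s))" for w t
  define W where "W n = (\<Phi> ^^ n) (\<lambda>_. 0)" for n
  have W0: "W 0 t = 0" and WS: "W (Suc n) t = \<delta> + integral {0..t} (\<lambda>s. g s (W n s))" for n t
    by (simp_all add: W_def \<Phi>_def)
  have integrable: "(\<lambda>s. g s (w s)) integrable_on {0..\<tau>}" if w: "continuous_on {0..\<tau>} w" for w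
  proof (rule measurable_bounded_by_integrable_imp_integrable[OF meas[OF w]])
    show "(\<lambda>s. L * norm (w s)) integrable_on {0..\<tau>}"
      by (intro integrable_continuous_interval continuous_intros w)
    show "norm (g s (w s)) \<le> L * norm (w s)" if "s \<in> {0..\<tau>}" for s
      using lip[OF that, of "w s" 0] zero[OF that] by simp
  qed auto
  have integrable': "(\<lambda>s. g s (w s)) integrable_on {0..t}"
    if "continuous_on {0..\<tau>} w" "t \<in> {0..\<tau>}" for w t
    by (rule integrable_on_subinterval[OF integrable[OF that(1)]]) (use that in auto)
  have contW: "continuous_on {0..\<tau>} (W n)" for n
  proof (induction n)
    case (Suc n)
    then have "continuous_on {0..\<tau>} (\<lambda>t. \<delta> + integral {0..t} (\<lambda>s. g s (W n s)))"
      by (intro continuous_intros indefinite_integral_continuous_1 integrable)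
    then show ?case by (simp add: WS)
  qed (simp add: W0)
  have int_diff: "norm (integral {0..t} (\<lambda>s. g s (v s)) - integral {0..t} (\<lambda>s. g s (w s))) \<le> A * exp (2 * L * t) / 2"
    if v: "continuous_on {0..\<tau>} v" and w: "continuous_on {0..\<tau>} w" and t: "t \<in> {0..\<tau>}" and A: "A \<ge> 0"
      and le: "\<And>s. s \<in> {0..t} \<Longrightarrow> norm (v s - w s) \<le> A * exp (2 * L * s)" for v w t A
  proof -
    have "norm (integral {0..t} (\<lambda>s. g s (v s)) - integral {0..t} (\<lambda>s. g s (w s)))
        = norm (integral {0..t} (\<lambda>s. g s (v s) - g s (w s)))"
      by (subst Henstock_Kurzweil_Integration.integral_diff[OF integrable'[OF v t] integrable'[OF w t]]) simp
    also have "\<dots> \<le> integral {0..t} (\<lambda>s. L * A * exp (2 * L * s))"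
    proof (rule integral_norm_bound_integral)
      show "(\<lambda>s. g s (v s) - g s (w s)) integrable_on {0..t}"
        by (intro Henstock_Kurzweil_Integration.integrable_diff integrable' v w t)
      show "(\<lambda>s. L * A * exp (2 * L * s)) integrable_on {0..t}"
        by (intro integrable_continuous_interval continuous_intros)
      fix s assume s: "s \<in> {0..t}"
      have "norm (g s (v s) - g s (w s)) \<le> L * norm (v s - w s)"
        using lip s t by auto
      also have "\<dots> \<le> L * (A * exp (2 * L * s))"
        using le[OF s] L by (intro mult_left_mono) auto
      finally show "norm (g s (v s) - g s (w s)) \<le> L * A * exp (2 * L * s)" by (simp add: mult.assoc)
    qed
    also have "\<dots> = L * A * ((exp (2 * L * t) - 1) / (2 * L))"
      using has_integral_exp_scaled[of "2 * L" 0 t] L t by (simp add: integral_unique)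
    also have "\<dots> = A * (exp (2 * L * t) - 1) / 2" using L by (simp add: field_simps)
    also have "\<dots> \<le> A * exp (2 * L * t) / 2" using A by (simp add: mult_left_mono divide_right_mono)
    finally show ?thesis .
  qed
  \<comment> \<open>Since \<open>g s 0 = 0\<close>, the first iterate is the constant
    \<open>\<delta>\<close>. From there the weighted increments halve, and the geometric series
    yields the factor 2 in the final bound.\<close>
  have step: "norm (W (Suc n) t - W n t) \<le> norm \<delta> / 2 ^ n * exp (2 * L * t)" if "t \<in> {0..\<tau>}" for n t
    using that
  proof (induction n arbitrary: t)
    case 0
    have "integral {0..t} (\<lambda>s. g s (W 0 s)) = integral {0..t} (\<lambda>s. 0)"
      by (rule integral_cong) (use 0 zero in \<open>auto simp: W0\<close>)
    then have "W (Suc 0) t = \<delta>" using WS[of 0 t] by simp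
    moreover have "1 \<le> exp (2 * L * t)" using L 0 by simp
    then have "norm \<delta> * 1 \<le> norm \<delta> * exp (2 * L * t)" by (intro mult_left_mono) auto
    ultimately show ?case by (simp add: W0)
  next
    case (Suc n)
    have "norm (W (Suc (Suc n)) t - W (Suc n) t) \<le> (norm \<delta> / 2 ^ n) * exp (2 * L * t) / 2"
      using int_diff[OF contW contW Suc.prems, of "norm \<delta> / 2 ^ n"  "Suc n" n] Suc by (simp add: WS)
    then show ?case by simp
  qed
  have lim: "\<exists>w. uniform_limit {0..\<tau>} W w sequentially"
  proof -
    have "uniformly_convergent_on {0..\<tau>} (\<lambda>n t. \<Sum>i<n. W (Suc i) t - W i t)"
    proof (rule Weierstrass_m_test'[unfolded uniformly_convergent_on_def[symmetric]])
      show "norm (W (Suc n) t - W n t) \<le> norm \<delta> * exp (2 * L * \<tau>) * (1/2) ^ n" if "t \<in> {0..\<tau>}" for n t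
      proof -
        have "exp (2 * L * t) \<le> exp (2 * L * \<tau>)" using that L by auto
        then have "norm \<delta> / 2 ^ n * exp (2 * L * t) \<le> norm \<delta> / 2 ^ n * exp (2 * L * \<tau>)" by (intro mult_left_mono) auto
        with step[OF that, of n] show ?thesis by (simp add: power_one_over field_simps)
      qed
      show "summable (\<lambda>n. norm \<delta> * exp (2 * L * \<tau>) * (1/2) ^ n)"
        by (intro summable_mult summable_geometric) auto
    qed
    moreover have "(\<Sum>i<n. W (Suc i) t - W i t) = W n t" for n t
      using sum_lessThan_telescope[of "\<lambda>i. W i t" n] by (simp add: W0)
    ultimately show ?thesis by (simp add: uniformly_convergent_on_def)
  qed
  then obtain w where w: "uniform_limit {0..\<tau>} W w sequentially" by blast
  have contw: "continuous_on {0..\<tau>} w"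
    by (rule uniform_limit_theorem[OF _ w]) (auto simp: contW)
  have pt: "(\<lambda>n. W n t) \<longlonglongrightarrow> w t" if "t \<in> {0..\<tau>}" for t
    using tendsto_uniform_limitI[OF w that] .
  show thesis
  proof (rule that[OF contw integrable[OF contw]])
    fix t assume t: "t \<in> {0..\<tau>}"
    have "(\<lambda>n. W (Suc n) t) \<longlonglongrightarrow> \<delta> + integral {0..t} (\<lambda>s. g s (w s))"
      unfolding tendsto_iff
    proof (intro allI impI)
      fix e :: real assume e: "e > 0"
      \<comment> \<open>With this tolerance \<open>int_diff\<close> gives an error of
        \<open>e / 2\<close> at time \<open>t\<close>.\<close>
      define A where "A = e / exp (2 * L * t)"
      have A: "A > 0" using e by (simp add: A_def)
      have "\<forall>\<^sub>F n in sequentially. \<forall>s\<in>{0..\<tau>}. dist (W n s) (w s) < A"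
        using w A by (auto simp: uniform_limit_iff)
      then show "\<forall>\<^sub>F n in sequentially. dist (W (Suc n) t) (\<delta> + integral {0..t} (\<lambda>s. g s (w s))) < e"
      proof eventually_elim
        case (elim n)
        have "norm (W n s - w s) \<le> A * exp (2 * L * s)" if "s \<in> {0..t}" for s
        proof -
          have "norm (W n s - w s) \<le> A * 1" using elim that t by (force simp: dist_norm)
          also have "\<dots> \<le> A * exp (2 * L * s)" using A L that by (intro mult_left_mono) auto
          finally show ?thesis .
        qed
        from int_diff[OF contW contw t _ this] A
        have "norm (integral {0..t} (\<lambda>s. g s (W n s)) - integral {0..t} (\<lambda>s. g s (w s))) \<le> A * exp (2 * L * t) / 2"
          by auto
        also have "\<dots> < e" using e by (simp add: A_def)
        finally show ?case by (simp add: WS dist_norm)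
      qed
    qed
    moreover have "(\<lambda>n. W (Suc n) t) \<longlonglongrightarrow> w t" using pt[OF t] by (rule LIMSEQ_Suc)
    ultimately show "w t = \<delta> + integral {0..t} (\<lambda>s. g s (w s))" using LIMSEQ_unique by blast
    have bnd: "norm (W n t) \<le> 2 * norm \<delta> * exp (2 * L * t)" for n
    proof -
      have "W n t = (\<Sum>i<n. W (Suc i) t - W i t)"
        using sum_lessThan_telescope[of "\<lambda>i. W i t" n] by (simp add: W0)
      also have "norm \<dots> \<le> (\<Sum>i<n. norm \<delta> * exp (2 * L * t) * (1/2) ^ i)"
        by (rule sum_norm_le) (use step[OF t] in \<open>simp add: power_one_over field_simps\<close>)
      also have "\<dots> = norm \<delta> * exp (2 * L * t) * (\<Sum>i<n. (1/2) ^ i)" by (simp add: sum_distrib_left)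
      also have "\<dots> \<le> norm \<delta> * exp (2 * L * t) * 2"
      proof (intro mult_left_mono)
        have "(\<Sum>i<n. (1/2::real) ^ i) = 2 - 2 * (1/2) ^ n" by (simp add: sum_gp_strict)
        then show "(\<Sum>i<n. (1/2::real) ^ i) \<le> 2" by simp
      qed auto
      finally show ?thesis by (simp add: mult_ac)
    qed
    show "norm (w t) \<le> 2 * norm \<delta> * exp (2 * L * t)"
      by (rule LIMSEQ_le_const2[OF tendsto_norm[OF pt[OF t]]]) (use bnd in auto)
  qed
qed

section \<open>Comparison functions\<close>

text \<open>The mean of \<open>h\<close> over the interval from \<open>r\<close> to
  \<open>2 * r\<close> is continuous in \<open>r\<close> even where \<open>h\<close> jumps, and by
  monotonicity it lies between \<open>h r\<close> and \<open>h (2 * r)\<close>. The additional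
  \<open>r\<close> makes the majorant strictly increasing.\<close>

lemma continuous_majorant_of_monotone:
  fixes h :: "real \<Rightarrow> real"
  assumes mono: "mono_on {0<..} h"
  obtains g where "continuous_on {0<..} g" "strict_mono_on {0<..} g"
    "\<And>r. r > 0 \<Longrightarrow> r + h r \<le> g r" "\<And>r. r > 0 \<Longrightarrow> g r \<le> r + h (2 * r)"
proof -
  define g where "g r = r + integral {1..2} (\<lambda>v. h (r * v))" for r
  have int: "(\<lambda>v. h (r * v)) integrable_on {1..2}" if "r > 0" for r
  proof (rule integrable_on_mono_on, rule mono_onI)
    fix v w :: real assume "v \<in> {1..2}" "w \<in> {1..2}" "v \<le> w"
    then show "h (r * v) \<le> h (r * w)"
      using that by (intro mono_onD[OF mono]) auto
  qed
  have le: "integral {1..2} (\<lambda>v. h (r * v)) \<le> integral {1..2} (\<lambda>v. h (s * v))" if "0 < r" "r \<le> s" for r s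
    by (rule integral_le) (use that int in \<open>auto intro!: mono_onD[OF mono]\<close>)
  have lower: "h r \<le> integral {1..2} (\<lambda>v. h (r * v))" if "r > 0" for r
  proof -
    have "integral {1..2::real} (\<lambda>v. h r) \<le> integral {1..2} (\<lambda>v. h (r * v))"
      by (rule integral_le) (use that int in \<open>auto intro!: mono_onD[OF mono]\<close>)
    then show ?thesis by simp
  qed
  have upper: "integral {1..2} (\<lambda>v. h (r * v)) \<le> h (2 * r)" if "r > 0" for r
  proof -
    have "integral {1..2} (\<lambda>v. h (r * v)) \<le> integral {1..2::real} (\<lambda>v. h (2 * r))"
      by (rule integral_le) (use that int in \<open>auto intro!: mono_onD[OF mono]\<close>)
    then show ?thesis by simp
  qed
  \<comment> \<open>Over the fixed interval \<open>{1..2}\<close> the mean is visibly monotone in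
    \<open>r\<close>. Written through indefinite integrals it is visibly continuous.\<close>
  have eq: "integral {1..2} (\<lambda>v. h (r * v)) = (integral {a..2*r} h - integral {a..r} h) / r"
    if r: "r > 0" "0 < a" "a \<le> r" for r a
  proof -
    have ih: "h integrable_on {c..d}" if "c > 0" for c d
      by (rule integrable_on_mono_on, rule mono_on_subset[OF mono]) (use that in auto)
    have "(h has_integral integral {r..2*r} h) (cbox r (2*r))"
      using ih[of r "2*r"] r by (simp add: has_integral_integral cbox_interval)
    note aff = has_integral_affinity'[OF this r(1), of 0]
    have two: "inverse r * (2 * r) = 2" using r by simp
    have "((\<lambda>v. h (r * v)) has_integral integral {r..2*r} h / r) {1..2}"
      using aff r(1) by (simp add: two divide_inverse_commute)
    then have "integral {1..2} (\<lambda>v. h (r * v)) = integral {r..2*r} h / r"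
      by (rule integral_unique)
    moreover have "integral {a..r} h + integral {r..2*r} h = integral {a..2*r} h"
      by (rule Henstock_Kurzweil_Integration.integral_combine) (use r ih in auto)
    ultimately show ?thesis by (simp add: algebra_simps)
  qed
  show thesis
  proof (rule that)
    show "strict_mono_on {0<..} g"
      by (rule strict_mono_onI) (use le in \<open>auto simp: g_def intro!: add_less_le_mono\<close>)
    show "\<And>r. r > 0 \<Longrightarrow> r + h r \<le> g r" using lower by (simp add: g_def)
    show "\<And>r. r > 0 \<Longrightarrow> g r \<le> r + h (2 * r)" using upper by (simp add: g_def)
    have "continuous_on {a<..<b} g" if ab: "0 < a" for a b
    proof -
      have ih: "h integrable_on {a..d}" for d
        by (rule integrable_on_mono_on, rule mono_on_subset[OF mono]) (use ab in auto)
      have ii: "continuous_on {a..2*b} (\<lambda>r. integral {a..r} h)"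
        by (rule indefinite_integral_continuous_1[OF ih])
      have "continuous_on {a<..<b} (\<lambda>r. r + (integral {a..2*r} h - integral {a..r} h) / r)"
        by (intro continuous_intros continuous_on_compose2[OF ii]) (use ab in auto)
      then show ?thesis
        by (rule continuous_on_eq) (use ab in \<open>auto simp: g_def eq[of _ a]\<close>)
    qed
    then have "isCont g r" if "r > 0" for r
      using that by (intro continuous_on_interior[of "{r/2<..<2*r}"]) (auto simp: interior_open)
    then show "continuous_on {0<..} g"
      by (auto intro!: continuous_at_imp_continuous_on)
  qed
qed

text \<open>Unboundedness is imposed in the stronger form \<open>r \<le> g r\<close>.\<close>

definition K_infinity :: "(real \<Rightarrow> real) \<Rightarrow> bool" where
  "K_infinity g \<longleftrightarrow> continuous_on {0..} g \<and> strict_mono_on {0..} g \<and> g 0 = 0 \<and> (\<forall>r\<ge>0. r \<le> g r)"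

text \<open>Continuity at 0 is the only new point: the upper bound \<open>r + h (2 * r)\<close> on
  the continuous majorant carries the limit of \<open>h\<close> over to it.\<close>

lemma K_infinity_majorant:
  fixes h :: "real \<Rightarrow> real"
  assumes mono: "mono_on {0<..} h" and nonneg: "\<And>r. r > 0 \<Longrightarrow> 0 \<le> h r"
    and lim: "(h \<longlongrightarrow> 0) (at_right 0)"
  obtains g where "K_infinity g" "\<And>r. r > 0 \<Longrightarrow> h r \<le> g r"
proof -
  obtain g0 where g0: "continuous_on {0<..} g0" "strict_mono_on {0<..} g0"
    "\<And>r. r > 0 \<Longrightarrow> r + h r \<le> g0 r" "\<And>r. r > 0 \<Longrightarrow> g0 r \<le> r + h (2 * r)"
    using continuous_majorant_of_monotone[OF mono] by blast
  define g where "g r = (if r \<le> 0 then 0 else g0 r)" for r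
  have ge: "r + h r \<le> g r" "r \<le> g r" if "r > 0" for r
    using g0(3)[OF that] nonneg[OF that] that by (auto simp: g_def)
  have "continuous (at r within {0..}) g" if "r \<ge> 0" for r
  proof (cases "r = 0")
    case True
    have l2: "filterlim (\<lambda>r::real. 2 * r) (at_right 0) (at_right 0)"
      by (auto simp: filterlim_at intro!: tendsto_eq_intros eventually_at_rightI[of 0 1])
    have "((\<lambda>r. r + h (2 * r)) \<longlongrightarrow> 0 + 0) (at_right 0)"
      by (intro tendsto_intros filterlim_compose[OF lim l2])
    then have lim0: "((\<lambda>r. r + h (2 * r)) \<longlongrightarrow> 0) (at_right 0)" by simp
    have "(g \<longlongrightarrow> 0) (at_right 0)"
    proof (rule tendsto_sandwich[OF _ _ tendsto_const lim0])
      show "\<forall>\<^sub>F r in at_right 0. 0 \<le> g r"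
        by (rule eventually_at_rightI[of 0 1]) (use ge(2) in \<open>force+\<close>)
      show "\<forall>\<^sub>F r in at_right 0. g r \<le> r + h (2 * r)"
        by (rule eventually_at_rightI[of 0 1]) (auto simp: g_def g0(4))
    qed
    moreover have "at (0::real) within {0..} = at_right 0"
      by (simp add: at_within_Ici_at_right)
    ultimately show ?thesis using True by (simp add: continuous_within g_def)
  next
    case False
    with that have r: "r > 0" by simp
    have "continuous_on {0<..} g"
      by (rule continuous_on_eq[OF g0(1)]) (simp add: g_def)
    with r have "isCont g r" by (simp add: continuous_on_eq_continuous_at)
    then show ?thesis by (rule continuous_at_imp_continuous_within)
  qed
  then have "continuous_on {0..} g" by (simp add: continuous_on_eq_continuous_within)
  moreover have "strict_mono_on {0..} g"
  proof (rule strict_mono_onI)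
    fix r s :: real assume "r \<in> {0..}" "s \<in> {0..}" "r < s"
    then show "g r < g s"
      using strict_mono_onD[OF g0(2), of r s] ge(2)[of s] by (cases "r = 0") (auto simp: g_def)
  qed
  moreover have "g 0 = 0" by (simp add: g_def)
  moreover have "\<forall>r\<ge>0. r \<le> g r" using ge(2) by (auto simp: g_def le_less)
  ultimately have "K_infinity g" by (simp add: K_infinity_def)
  moreover have "h r \<le> g r" if "r > 0" for r using ge(1)[OF that] that by simp
  ultimately show thesis by (rule that)
qed

text \<open>The descent rate is built in this shape because time enters only through an exponential
  factor, so that the factors of consecutive arcs multiply.\<close>

lemma KL_function_K_infinity_exp:
  assumes G: "K_infinity G" and A: "K_infinity A"
  shows "KL_function (\<lambda>r t. G (A r * exp (- t)))"
proof -
  have G0: "continuous_on {0..} G" "strict_mono_on {0..} G" "G 0 = 0" "\<And>r. r \<ge> 0 \<Longrightarrow> r \<le> G r"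
    and A0: "continuous_on {0..} A" "strict_mono_on {0..} A" "A 0 = 0" "\<And>r. r \<ge> 0 \<Longrightarrow> r \<le> A r"
    using G A by (auto simp: K_infinity_def)
  have Apos: "A r \<ge> 0" if "r \<ge> 0" for r using A0(4)[OF that] that by simp
  have Gpos: "G r \<ge> 0" if "r \<ge> 0" for r using G0(4)[OF that] that by simp
  show ?thesis
    unfolding KL_function_def
  proof (intro conjI allI impI)
    have "continuous_on ({0..} \<times> {0..}) (\<lambda>p. G (A (fst p) * exp (- snd p)))"
      by (intro continuous_on_compose2[OF G0(1)] continuous_on_compose2[OF A0(1)] continuous_intros)
         (auto intro!: mult_nonneg_nonneg Apos)
    then show "continuous_on ({0..} \<times> {0..}) (\<lambda>(r, t). G (A r * exp (- t)))"
      by (simp add: case_prod_unfold)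
    show "0 \<le> G (A r * exp (- t))" if "0 \<le> r" for r t :: real
      by (intro Gpos mult_nonneg_nonneg Apos that) auto
    fix t :: real assume "0 \<le> t"
    show "G (A 0 * exp (- t)) = 0" by (simp add: G0 A0)
    show "strict_mono_on {0..} (\<lambda>r. G (A r * exp (- t)))"
    proof (rule strict_mono_onI)
      fix r s :: real assume rs: "r \<in> {0..}" "s \<in> {0..}" "r < s"
      then have "A r < A s" by (intro strict_mono_onD[OF A0(2)]) auto
      then show "G (A r * exp (- t)) < G (A s * exp (- t))"
        using rs Apos by (intro strict_mono_onD[OF G0(2)]) auto
    qed
    show "\<not> bdd_above ((\<lambda>r. G (A r * exp (- t))) ` {0..})"
    proof
      assume "bdd_above ((\<lambda>r. G (A r * exp (- t))) ` {0..})"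
      then obtain M where M: "\<And>r. r \<ge> 0 \<Longrightarrow> G (A r * exp (- t)) \<le> M"
        by (auto simp: bdd_above_def)
      \<comment> \<open>Both \<open>A\<close> and \<open>G\<close> dominate the identity, so undoing
        the factor \<open>exp (- t)\<close> in advance leaves a value of at least
        \<open>\<bar>M\<bar> + 1\<close>.\<close>
      define r where "r = (\<bar>M\<bar> + 1) * exp t"
      have r: "r \<ge> 0" by (simp add: r_def)
      have "\<bar>M\<bar> + 1 = r * exp (- t)" by (simp add: r_def exp_minus field_simps)
      also have "\<dots> \<le> A r * exp (- t)" using A0(4)[OF r] by simp
      also have "\<dots> \<le> G (A r * exp (- t))" using Apos[OF r] by (intro G0(4)) auto
      also have "\<dots> \<le> M" using M r by blast
      finally show False by linarith
    qed
  next
    fix r :: real assume r: "r > 0"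
    have "A r > 0" using A0(4)[of r] r by linarith
    then show "strict_antimono_on {0..} (\<lambda>t. G (A r * exp (- t)))"
      by (intro monotone_onI strict_mono_onD[OF G0(2)]) auto
  next
    fix r :: real assume r: "r \<ge> 0"
    have "((\<lambda>t. A r * exp (- t)) \<longlongrightarrow> A r * 0) at_top"
      by (intro tendsto_intros filterlim_compose[OF exp_at_bot] filterlim_uminus_at_bot_at_top)
    then have "((\<lambda>t. A r * exp (- t)) \<longlongrightarrow> 0) at_top" by simp
    moreover have "\<forall>\<^sub>F t in at_top. A r * exp (- t) \<in> {0..}" using Apos[OF r] by auto
    ultimately have "((\<lambda>t. G (A r * exp (- t))) \<longlongrightarrow> G 0) at_top"
      by (intro continuous_on_tendsto_compose[OF G0(1)]) auto
    then show "((\<lambda>t. G (A r * exp (- t))) \<longlongrightarrow> 0) at_top" by (simp add: G0)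
  qed
qed

section \<open>Arcs with bounded controls and their perturbation\<close>

text \<open>Negligible sets can be translated and united over countably many arcs directly, so
  almost everywhere statements are exchanged for them.\<close>

lemma AE_lebesgue_on_iff_negligible:
  fixes S :: "'a::euclidean_space set"
  assumes "S \<in> sets lebesgue"
  shows "(AE t in lebesgue_on S. P t) \<longleftrightarrow> negligible {t\<in>S. \<not> P t}"
proof -
  have "(AE t in lebesgue_on S. P t) \<longleftrightarrow> (AE t in lebesgue. t \<in> S \<longrightarrow> P t)"
    by (rule AE_restrict_space_iff) (simp add: assms)
  also have "\<dots> \<longleftrightarrow> (\<exists>N\<in>null_sets lebesgue. {t\<in>S. \<not> P t} \<subseteq> N)"
    unfolding eventually_ae_filter by (simp only: space_completion space_lborel space_borel UNIV_I simp_thms not_imp)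
  also have "\<dots> \<longleftrightarrow> negligible {t\<in>S. \<not> P t}"
    by (metis negligible_iff_null_sets negligible_subset subset_refl)
  finally show ?thesis .
qed

lemma time_domain_lebesgue: "time_domain T \<in> sets lebesgue"
proof -
  have "time_domain T = {0..} \<inter> (if T = \<infinity> then UNIV else if T = -\<infinity> then {} else {..<real_of_ereal T})"
    by (cases T) (auto simp: time_domain_def)
  then show ?thesis by simp
qed

text \<open>The interval is closed so that the endpoint of an arc can serve as the start of the next
  one. The derivative is required only in the open interval, where it is two-sided and hence
  unaffected by later gluing.\<close>

definition controlled_arc ::
    "'a::euclidean_space set \<Rightarrow> ('a \<Rightarrow> 'b::euclidean_space \<Rightarrow> 'a) \<Rightarrow> 'b set \<Rightarrow>
     real \<Rightarrow> real \<Rightarrow> (real \<Rightarrow> 'a) \<Rightarrow> (real \<Rightarrow> 'b) \<Rightarrow> bool" where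
  "controlled_arc C f U M \<tau> y u \<longleftrightarrow>
     0 < \<tau> \<and>
     u \<in> borel_measurable (lebesgue_on {0..\<tau>}) \<and>
     negligible {t\<in>{0..\<tau>}. \<not> (u t \<in> U \<and> norm (u t) \<le> M)} \<and>
     (\<forall>t\<in>{0..\<tau>}. y t \<notin> C) \<and>
     absolutely_continuous_on {0..\<tau>} y \<and>
     negligible {t\<in>{0<..<\<tau>}. \<not> (y has_vector_derivative f (y t) (u t)) (at t)}"

text \<open>Because \<open>\<tau>\<close> lies strictly before \<open>T\<close>, the interval
  \<open>{0..\<tau>}\<close> is a compact subset of the time domain; the local essential bound on
  \<open>u\<close> then supplies \<open>M\<close>.\<close>

lemma controlled_arc_of_admissible_pair:
  assumes adm: "admissible_pair C f U T x u" and \<tau>: "0 < \<tau>" "ereal \<tau> < T"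
  obtains M where "controlled_arc C f U M \<tau> x u"
proof -
  have sub: "{0..\<tau>} \<subseteq> time_domain T"
    using \<tau> by (auto simp: time_domain_def intro: le_less_trans[of _ "ereal \<tau>"])
  have u: "u \<in> borel_measurable (lebesgue_on (time_domain T))"
    "AE t in lebesgue_on (time_domain T). u t \<in> U"
    "\<And>K. compact K \<Longrightarrow> K \<subseteq> time_domain T \<Longrightarrow> \<exists>M. AE t in lebesgue_on K. norm (u t) \<le> M"
    using adm by (auto simp: admissible_pair_def Linf_loc_def)
  obtain M where M: "AE t in lebesgue_on {0..\<tau>}. norm (u t) \<le> M"
    using u(3)[OF _ sub] by auto
  have "controlled_arc C f U M \<tau> x u"
    unfolding controlled_arc_def
  proof (intro conjI \<tau>(1))
    show "u \<in> borel_measurable (lebesgue_on {0..\<tau>})"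
      by (rule measurable_restrict_mono[OF u(1) sub])
    have "negligible {t\<in>time_domain T. \<not> u t \<in> U}" "negligible {t\<in>{0..\<tau>}. \<not> norm (u t) \<le> M}"
      using u(2) M by (simp_all add: AE_lebesgue_on_iff_negligible time_domain_lebesgue)
    then show "negligible {t\<in>{0..\<tau>}. \<not> (u t \<in> U \<and> norm (u t) \<le> M)}"
      by (rule negligible_subset[OF negligible_Un]) (use sub in auto)
    show "\<forall>t\<in>{0..\<tau>}. x t \<notin> C" "absolutely_continuous_on {0..\<tau>} x"
      using adm sub by (auto simp: admissible_pair_def locally_absolutely_continuous_on_def)
    have "negligible {t\<in>time_domain T. \<not> (x has_vector_derivative f (x t) (u t)) (at t within time_domain T)}"
      using adm by (simp add: admissible_pair_def AE_lebesgue_on_iff_negligible time_domain_lebesgue)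
    then show "negligible {t\<in>{0<..<\<tau>}. \<not> (x has_vector_derivative f (x t) (u t)) (at t)}"
    proof (rule negligible_subset, clarify)
      fix t assume t: "t \<in> {0<..<\<tau>}" "\<not> (x has_vector_derivative f (x t) (u t)) (at t)"
      have "{0<..<\<tau>} \<subseteq> time_domain T"
        by (rule order_trans[OF _ sub]) auto
      then have "t \<in> interior (time_domain T)"
        using interior_maximal[of "{0<..<\<tau>}" "time_domain T"] t(1) by auto
      then have "at t within time_domain T = at t" by (rule at_within_interior)
      then show "t \<in> time_domain T \<and> \<not> (x has_vector_derivative f (x t) (u t)) (at t within time_domain T)"
        using t sub by auto
    qed
  qed
  then show thesis by (rule that)
qed

text \<open>Extended by 0 outside \<open>A \<times> U\<close>, the map \<open>f\<close> is Borel on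
  the whole product, and a Borel map may be composed with a Lebesgue measurable one. The default 0
  takes care of the times at which \<open>u\<close> leaves \<open>U\<close>.\<close>

lemma Caratheodory_measurable:
  fixes f :: "'a::euclidean_space \<Rightarrow> 'b::euclidean_space \<Rightarrow> 'c::euclidean_space" and A :: "'a set" and U :: "'b set"
  assumes f: "continuous_on (A \<times> U) (\<lambda>(x, u). f x u)" and A: "A \<in> sets borel" and U: "U \<in> sets borel"
    and y: "continuous_on {a..b::real} y" "y ` {a..b} \<subseteq> A" and u: "u \<in> borel_measurable (lebesgue_on {a..b})"
  shows "(\<lambda>s. if u s \<in> U then f (y s) (u s) else 0) \<in> borel_measurable (lebesgue_on {a..b})"
proof -
  have "A \<times> U \<in> sets (borel :: ('a \<times> 'b) measure)"
    using A U by (auto simp: borel_prod[symmetric])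
  then have [measurable]: "(\<lambda>p. indicator (A \<times> U) p *\<^sub>R (case p of (x, u) \<Rightarrow> f x u)) \<in> borel_measurable borel"
    using f by (rule borel_measurable_continuous_on_indicator)
  have [measurable]: "y \<in> borel_measurable (lebesgue_on {a..b})"
    by (rule continuous_imp_measurable_on_sets_lebesgue[OF y(1)]) auto
  note u[measurable]
  have "(\<lambda>s. indicator (A \<times> U) (y s, u s) *\<^sub>R (case (y s, u s) of (x, u) \<Rightarrow> f x u)) \<in> borel_measurable (lebesgue_on {a..b})"
    by measurable
  then show ?thesis
    by (rule measurable_cong[THEN iffD1, rotated]) (use y(2) in \<open>auto simp: indicator_def image_subset_iff\<close>)
qed

text \<open>
  The difference \<open>w\<close> to the given arc solves an integral equation whose right-hand side is
  Lipschitz only near \<open>0\<close>. Composing with the projection \<open>P\<close> onto a small ball makes it globally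
  Lipschitz, and the a priori bound on \<open>w\<close> shows that \<open>P\<close> is not active.
\<close>

lemma perturb_controlled_arc:
  fixes C :: "'a::euclidean_space set" and U :: "'b::euclidean_space set"
  assumes arc: "controlled_arc C f U M \<tau> x u"
    and C: "closed C" and U: "closed U"
    and cont: "continuous_on ((- C) \<times> U) (\<lambda>(x, u). f x u)"
    and lip: "\<And>K U1. compact K \<Longrightarrow> K \<subseteq> - C \<Longrightarrow> compact U1 \<Longrightarrow> U1 \<subseteq> U \<Longrightarrow>
           \<exists>L>0. \<forall>x\<in>K. \<forall>y\<in>K. \<forall>u\<in>U1. norm (f x u - f y u) \<le> L * norm (x - y)"
    and \<rho>: "0 < \<rho>"
  obtains d where "0 < d" "\<And>z. norm (z - x 0) < d \<Longrightarrow>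
     \<exists>y. controlled_arc C f U M \<tau> y u \<and> y 0 = z \<and> (\<forall>t\<in>{0..\<tau>}. norm (y t - x t) \<le> \<rho>)"
proof -
  have \<tau>: "0 < \<tau>" and meas_u: "u \<in> borel_measurable (lebesgue_on {0..\<tau>})"
    and negu: "negligible {t\<in>{0..\<tau>}. \<not> (u t \<in> U \<and> norm (u t) \<le> M)}"
    and xC: "\<And>t. t \<in> {0..\<tau>} \<Longrightarrow> x t \<notin> C" and acx: "absolutely_continuous_on {0..\<tau>} x"
    and negx: "negligible {t\<in>{0<..<\<tau>}. \<not> (x has_vector_derivative f (x t) (u t)) (at t)}"
    using arc by (auto simp: controlled_arc_def)
  have contx: "continuous_on {0..\<tau>} x" by (rule absolutely_continuous_on_imp_continuous_on[OF acx])
  define X where "X = x ` {0..\<tau>}"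
  have X: "compact X" "X \<subseteq> - C"
    using xC by (auto simp: X_def intro!: compact_continuous_image contx)
  obtain \<rho>0 where \<rho>0: "\<rho>0 > 0" "(\<Union>p\<in>X. cball p \<rho>0) \<subseteq> - C"
    using compact_subset_open_imp_cball_epsilon_subset[OF X(1) _ X(2)] C by (auto simp: open_Compl)
  define r where "r = min \<rho> \<rho>0"
  have r: "r > 0" "r \<le> \<rho>" "r \<le> \<rho>0" using \<rho> \<rho>0 by (auto simp: r_def)
  \<comment> \<open>A compact neighbourhood of the given arc, still off \<open>C\<close>: the
    Lipschitz constant for it covers every state that the truncated equation can meet.\<close>
  define K where "K = {p + q |p q. p \<in> X \<and> q \<in> cball 0 r}"
  have K: "compact K" unfolding K_def by (intro compact_sums X compact_cball)
  have KC: "K \<subseteq> - C"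
  proof
    fix p assume "p \<in> K"
    then obtain p' q where "p = p' + q" "p' \<in> X" "norm q \<le> r" by (auto simp: K_def)
    then have "p \<in> cball p' \<rho>0" "p' \<in> X" using r by (auto simp: dist_norm)
    then show "p \<in> - C" using \<rho>0(2) by blast
  qed
  define U1 where "U1 = U \<inter> cball 0 M"
  have U1: "compact U1" "U1 \<subseteq> U" using U by (auto simp: U1_def closed_Int_compact)
  obtain L where L: "L > 0" "\<And>x y u. x \<in> K \<Longrightarrow> y \<in> K \<Longrightarrow> u \<in> U1 \<Longrightarrow> norm (f x u - f y u) \<le> L * norm (x - y)"
    using lip[OF K KC U1] by blast
  define P where "P = closest_point (cball (0::'a) r)"
  have P_lip: "norm (P v - P w) \<le> norm (v - w)" for v w
    using closest_point_lipschitz[of "cball (0::'a) r" v w] r by (simp add: P_def dist_norm)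
  have P_in: "P v \<in> cball 0 r" for v
    unfolding P_def by (rule closest_point_in_set) (use r in auto)
  have P_self: "P v = v" if "norm v \<le> r" for v
    unfolding P_def by (rule closest_point_self) (use that in auto)
  have xK: "x s + P v \<in> K" "x s \<in> K" if "s \<in> {0..\<tau>}" for s v
  proof -
    have "x s \<in> X" "P v \<in> cball 0 r" "0 \<in> cball 0 r" "x s = x s + 0"
      using that P_in[of v] r by (auto simp: X_def)
    then show "x s + P v \<in> K" "x s \<in> K" unfolding K_def by blast+
  qed
  have xPC: "x s + P v \<notin> C" if "s \<in> {0..\<tau>}" for s v
    using xK(1)[OF that] KC by blast
  \<comment> \<open>Subtracting the velocity of the given arc makes 0 an equilibrium. On the null
    set where the control is outside \<open>U1\<close>, both terms are 0, so the Lipschitz estimate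
    holds at every time and not merely almost everywhere.\<close>
  define g where "g s v = (if u s \<in> U1 then f (x s + P v) (u s) else 0) - (if u s \<in> U1 then f (x s) (u s) else 0)" for s v
  have g_lip: "norm (g s v - g s w) \<le> L * norm (v - w)" if "s \<in> {0..\<tau>}" for s v w
  proof (cases "u s \<in> U1")
    case True
    have "norm (g s v - g s w) \<le> L * norm (P v - P w)"
      using L(2)[OF xK(1) xK(1) True, of s s v w] that True by (simp add: g_def)
    also have "\<dots> \<le> L * norm (v - w)" using P_lip L by (intro mult_left_mono) auto
    finally show ?thesis .
  qed (use L in \<open>auto simp: g_def\<close>)
  have P0: "P 0 = 0" using r by (intro P_self) auto
  have g0: "g s 0 = 0" for s by (simp add: g_def P0)
  have contU1: "continuous_on ((- C) \<times> U1) (\<lambda>(x, u). f x u)"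
    by (rule continuous_on_subset[OF cont]) (use U1 in auto)
  have bor: "- C \<in> sets borel" "U1 \<in> sets borel"
    using C U1 by (auto intro: borel_open borel_closed compact_imp_closed simp: open_Compl)
  have contP: "continuous_on S P" for S
    unfolding P_def using r by (intro continuous_on_closest_point) auto
  have g_meas: "(\<lambda>s. g s (w s)) \<in> borel_measurable (lebesgue_on {0..\<tau>})" if w: "continuous_on {0..\<tau>} w" for w
    unfolding g_def
  proof (intro borel_measurable_diff)
    show "(\<lambda>s. if u s \<in> U1 then f (x s + P (w s)) (u s) else 0) \<in> borel_measurable (lebesgue_on {0..\<tau>})"
      by (rule Caratheodory_measurable[OF contU1 bor _ _ meas_u])
         (use xPC in \<open>auto intro!: continuous_intros contx continuous_on_compose2[OF contP w]\<close>)
    show "(\<lambda>s. if u s \<in> U1 then f (x s) (u s) else 0) \<in> borel_measurable (lebesgue_on {0..\<tau>})"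
      by (rule Caratheodory_measurable[OF contU1 bor _ _ meas_u]) (use xC contx in auto)
  qed
  \<comment> \<open>Chosen so that the Picard bound \<open>2 * d * exp (2 * L * \<tau>)\<close>
    equals \<open>r\<close>, the radius within which \<open>P\<close> is the identity.\<close>
  define d where "d = r / (2 * exp (2 * L * \<tau>))"
  have d: "d > 0" using r by (simp add: d_def)
  show thesis
  proof (rule that[OF d])
    fix z assume z: "norm (z - x 0) < d"
    obtain w where w: "continuous_on {0..\<tau>} w"
      "(\<lambda>s. g s (w s)) integrable_on {0..\<tau>}"
      "\<And>t. t \<in> {0..\<tau>} \<Longrightarrow> w t = (z - x 0) + integral {0..t} (\<lambda>s. g s (w s))"
      "\<And>t. t \<in> {0..\<tau>} \<Longrightarrow> norm (w t) \<le> 2 * norm (z - x 0) * exp (2 * L * t)"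
      by (rule Picard_iteration[OF L(1) g_lip g0 g_meas, where \<delta> = "z - x 0"]) (assumption | rule that)+
    have wr: "norm (w t) \<le> r" if t: "t \<in> {0..\<tau>}" for t
    proof -
      have "norm (w t) \<le> 2 * norm (z - x 0) * exp (2 * L * t)" by (rule w(4)[OF t])
      also have "\<dots> \<le> 2 * d * exp (2 * L * \<tau>)" using z t d L(1) by (intro mult_mono) auto
      also have "\<dots> = r" by (simp add: d_def)
      finally show ?thesis .
    qed
    define y where "y t = x t + w t" for t
    have g_bnd: "norm (g s (w s)) \<le> L * r" if "s \<in> {0..\<tau>}" for s
    proof -
      have "norm (g s (w s)) \<le> L * norm (w s)" using g_lip[OF that, of "w s" 0] g0[of s] by simp
      also have "\<dots> \<le> L * r" using wr[OF that] L(1) by (intro mult_left_mono) auto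
      finally show ?thesis .
    qed
    have w_diff: "norm (w t - w s) \<le> (L * r) * (t - s)" if "s \<in> {0..\<tau>}" "t \<in> {0..\<tau>}" "s \<le> t" for s t
    proof -
      have int: "(\<lambda>s. g s (w s)) integrable_on {p..q}" if "{p..q} \<subseteq> {0..\<tau>}" for p q
        by (rule integrable_on_subinterval[OF w(2) that])
      have "integral {0..s} (\<lambda>s. g s (w s)) + integral {s..t} (\<lambda>s. g s (w s)) = integral {0..t} (\<lambda>s. g s (w s))"
        by (rule Henstock_Kurzweil_Integration.integral_combine) (use that in \<open>auto intro!: int\<close>)
      then have "integral {s..t} (\<lambda>s. g s (w s)) = integral {0..t} (\<lambda>s. g s (w s)) - integral {0..s} (\<lambda>s. g s (w s))"
        by (simp add: eq_diff_eq add.commute)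
      also have "\<dots> = w t - w s"
        by (simp only: w(3)[OF that(1)] w(3)[OF that(2)] add_diff_cancel_left)
      finally have "w t - w s = integral {s..t} (\<lambda>s. g s (w s))" by simp
      moreover have "norm (integral {s..t} (\<lambda>s. g s (w s))) \<le> (L * r) * measure lborel {s..t}"
        unfolding interval_cbox
        by (rule integrable_bound[where 'a=real]) (use that g_bnd L r in \<open>auto intro!: int\<close>)
      ultimately show ?thesis using that by simp
    qed
    have "absolutely_continuous_on {0..\<tau>} w"
    proof (rule lipschitz_imp_absolutely_continuous_on)
      fix s t assume "s \<in> {0..\<tau>}" "t \<in> {0..\<tau>}"
      then show "norm (w t - w s) \<le> (L * r) * \<bar>t - s\<bar>"
        using w_diff[of s t] w_diff[of t s] by (cases "s \<le> t") (auto simp: norm_minus_commute)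
    qed
    then have acy: "absolutely_continuous_on {0..\<tau>} y"
      unfolding y_def by (intro absolutely_continuous_on_add acx)
    have yK: "y t \<in> K" if "t \<in> {0..\<tau>}" for t
      using xK(1)[OF that, of "w t"] P_self[OF wr[OF that]] by (simp add: y_def)
    have dw: "(w has_vector_derivative g t (w t)) (at t)"
      if t: "t \<in> {0<..<\<tau>}" and D: "((\<lambda>s. integral {0..s} (\<lambda>s. g s (w s))) has_vector_derivative g t (w t)) (at t)" for t
    proof -
      have "((\<lambda>t. (z - x 0) + integral {0..t} (\<lambda>s. g s (w s))) has_vector_derivative 0 + g t (w t)) (at t)"
        by (intro derivative_intros D)
      then have "((\<lambda>t. (z - x 0) + integral {0..t} (\<lambda>s. g s (w s))) has_vector_derivative g t (w t)) (at t)" by simp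
      then show ?thesis
        by (rule has_vector_derivative_transform_within_open[where S = "{0<..<\<tau>}"]) (use t w(3) in auto)
    qed
    have negy: "negligible {t\<in>{0<..<\<tau>}. \<not> (y has_vector_derivative f (y t) (u t)) (at t)}"
    proof (rule negligible_subset[OF negligible_Un[OF negligible_Un[OF negx negu]
          indefinite_integral_has_vector_derivative_ae[OF w(2)]]], rule subsetI, rule ccontr)
      fix t
      assume t: "t \<in> {t\<in>{0<..<\<tau>}. \<not> (y has_vector_derivative f (y t) (u t)) (at t)}"
        and n: "t \<notin> {t \<in> {0<..<\<tau>}. \<not> (x has_vector_derivative f (x t) (u t)) (at t)} \<union>
              {t \<in> {0..\<tau>}. \<not> (u t \<in> U \<and> norm (u t) \<le> M)} \<union>
              {t \<in> {0<..<\<tau>}. \<not> ((\<lambda>s. integral {0..s} (\<lambda>s. g s (w s))) has_vector_derivative g t (w t)) (at t)}"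
      from t have t': "t \<in> {0<..<\<tau>}" "t \<in> {0..\<tau>}" by auto
      with n have "(x has_vector_derivative f (x t) (u t)) (at t)" "(w has_vector_derivative g t (w t)) (at t)"
        and u1: "u t \<in> U1" using dw by (auto simp: U1_def)
      then have "(y has_vector_derivative f (x t) (u t) + g t (w t)) (at t)"
        unfolding y_def by (intro derivative_intros)
      moreover have "f (x t) (u t) + g t (w t) = f (y t) (u t)"
        using u1 P_self[OF wr[OF t'(2)]] by (simp add: g_def y_def)
      ultimately show False using t by simp
    qed
    have "controlled_arc C f U M \<tau> y u"
      unfolding controlled_arc_def using \<tau> meas_u negu acy negy yK KC by blast
    moreover have "y 0 = z" using w(3)[of 0] \<tau> by (simp add: y_def)
    moreover have "norm (y t - x t) \<le> \<rho>" if "t \<in> {0..\<tau>}" for t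
      using wr[OF that] r by (simp add: y_def)
    ultimately show "\<exists>y. controlled_arc C f U M \<tau> y u \<and> y 0 = z \<and> (\<forall>t\<in>{0..\<tau>}. norm (y t - x t) \<le> \<rho>)"
      by blast
  qed
qed

section \<open>Uniform descent between distance levels\<close>

text \<open>The segment to a nearest point of \<open>C\<close> meets the frontier. As
  \<open>C\<close> itself may be unbounded, comparison with the frontier is what provides
  compactness, both for the annuli and for the limit point of a trajectory.\<close>

lemma infdist_frontier_close:
  fixes C :: "'a::euclidean_space set"
  assumes C: "closed C" "C \<noteq> {}" and z: "z \<notin> C"
  shows "\<exists>p\<in>frontier C. dist z p \<le> infdist z C"
proof -
  obtain c where c: "c \<in> C" "infdist z C = dist z c"
    using infdist_attains_inf[OF C] by blast
  have "closed_segment z c \<inter> frontier C \<noteq> {}"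
    by (rule connected_Int_frontier) (use c z in auto)
  then obtain p where p: "p \<in> closed_segment z c" "p \<in> frontier C" by blast
  have "dist z p \<le> dist z c"
    using segment_bound(1)[OF p(1)] by (simp add: dist_norm norm_minus_commute)
  with p c show ?thesis by auto
qed

text \<open>The condition \<open>0 < r\<close> keeps \<open>C\<close>, possibly unbounded, out of
  the set; all remaining points are within \<open>s\<close> of the bounded frontier.\<close>

lemma compact_infdist_annulus:
  fixes C :: "'a::euclidean_space set"
  assumes C: "closed C" "C \<noteq> {}" "compact (frontier C)" and r: "0 < r"
  shows "compact {z. infdist z C \<in> {r..s}}"
proof -
  obtain B where B: "\<And>p. p \<in> frontier C \<Longrightarrow> norm p \<le> B"
    using compact_imp_bounded[OF C(3)] by (auto simp: bounded_iff)
  have "norm z \<le> B + s" if z: "infdist z C \<in> {r..s}" for z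
  proof -
    have "z \<notin> C" using z r by auto
    then obtain p where "p \<in> frontier C" "dist z p \<le> infdist z C"
      using infdist_frontier_close[OF C(1,2)] by blast
    then show ?thesis using z B[of p] norm_triangle_sub[of z p] by (simp add: dist_norm)
  qed
  then have "bounded {z. infdist z C \<in> {r..s}}" by (auto simp: bounded_iff)
  moreover have "closed ((\<lambda>z. infdist z C) -` {r..s})"
    by (intro closed_vimage continuous_intros closed_atLeastAtMost)
  ultimately show ?thesis by (simp add: compact_eq_bounded_closed vimage_def)
qed

lemma infdist_perturb: "norm (y - x) \<le> e \<Longrightarrow> \<bar>infdist y C - infdist x C\<bar> \<le> e"
  using infdist_triangle_abs[of y C x] by (simp add: dist_norm)

text \<open>The strict inequality at the end matters: with \<open>r\<close> a power of 2, it forces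
  the dyadic index of the endpoint below that of \<open>r\<close>, so that the next arc starts in a
  lower annulus.\<close>

definition descending_arc ::
    "'a::euclidean_space set \<Rightarrow> ('a \<Rightarrow> 'b::euclidean_space \<Rightarrow> 'a) \<Rightarrow> 'b set \<Rightarrow>
     real \<Rightarrow> real \<Rightarrow> real \<Rightarrow> real \<Rightarrow> 'a \<Rightarrow> real \<Rightarrow> (real \<Rightarrow> 'a) \<Rightarrow> (real \<Rightarrow> 'b) \<Rightarrow> bool" where
  "descending_arc C f U r B \<Theta> M z \<tau> y u \<longleftrightarrow> controlled_arc C f U M \<tau> y u \<and> y 0 = z \<and> \<tau> \<le> \<Theta> \<and>
    (\<forall>t\<in>{0..\<tau>}. infdist (y t) C \<in> {r/4..B}) \<and> infdist (y \<tau>) C < r"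

lemma controlled_arc_mono: "controlled_arc C f U M \<tau> y u \<Longrightarrow> M \<le> M' \<Longrightarrow> controlled_arc C f U M' \<tau> y u"
  by (auto simp: controlled_arc_def elim!: negligible_subset)

text \<open>The infimum of the closed level set is attained. A value below \<open>c\<close> before
  that time would, by the intermediate value theorem, produce an earlier hit.\<close>

lemma first_hitting_time:
  fixes h :: "real \<Rightarrow> real"
  assumes h: "continuous_on {0..s} h" and s: "0 \<le> s" "h s \<le> c" and c: "c < h 0"
  obtains \<tau> where "0 < \<tau>" "\<tau> \<le> s" "h \<tau> = c" "\<And>t. t \<in> {0..\<tau>} \<Longrightarrow> c \<le> h t"
proof -
  have hit: "\<exists>t'\<in>{0..t}. h t' = c" if "t \<in> {0..s}" "h t \<le> c" for t
    using IVT2'[of h t c 0] that c continuous_on_subset[OF h, of "{0..t}"] by auto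
  let ?S = "{t\<in>{0..s}. h t = c}"
  have "closed ?S" using continuous_closed_preimage_constant[OF h] by simp
  moreover have "?S \<noteq> {}" using hit[of s] s by auto
  moreover have bdd: "bdd_below ?S" by (rule bdd_belowI[of _ 0]) auto
  ultimately have S: "Inf ?S \<in> ?S" by (intro closed_contains_Inf)
  show thesis
  proof (rule that[of "Inf ?S"])
    show "0 < Inf ?S" using S c by (cases "Inf ?S = 0") auto
    show "Inf ?S \<le> s" "h (Inf ?S) = c" using S by auto
    fix t assume t: "t \<in> {0..Inf ?S}"
    show "c \<le> h t"
    proof (rule ccontr)
      assume "\<not> ?thesis"
      then have lt: "h t < c" by simp
      then obtain t' where t': "t' \<in> {0..t}" "h t' = c" using hit[of t] t S by auto
      then have "Inf ?S \<le> t'" using t S by (intro cInf_lower bdd) auto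
      then have "Inf ?S = t'" using t' t by auto
      then have "t = t'" using t' t by auto
      with lt t' show False by simp
    qed
  qed
qed

text \<open>Only \<open>M\<close> comes from compactness. Since \<open>\<beta> (2*r)\<close>
  dominates the rate of every starting point in the annulus, the duration and the ceiling depend on
  \<open>r\<close> alone. The summand \<open>r\<close> in the ceiling amply covers the displacement
  of at most \<open>r/4\<close> caused by the perturbation.\<close>

lemma GAC_uniform_descent:
  fixes C :: "'a::euclidean_space set" and U :: "'b::euclidean_space set"
  assumes C: "closed C" "C \<noteq> {}" "compact (frontier C)" and U: "closed U"
    and cont: "continuous_on ((- C) \<times> U) (\<lambda>(x, u). f x u)"
    and lip: "\<And>K U1. compact K \<Longrightarrow> K \<subseteq> - C \<Longrightarrow> compact U1 \<Longrightarrow> U1 \<subseteq> U \<Longrightarrow>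
           \<exists>L>0. \<forall>x\<in>K. \<forall>y\<in>K. \<forall>u\<in>U1. norm (f x u - f y u) \<le> L * norm (x - y)"
    and KL: "KL_function \<beta>"
    and traj: "\<And>z. z \<notin> C \<Longrightarrow> \<exists>T x u. admissible_pair C f U T x u \<and> x 0 = z \<and>
          (\<forall>t\<ge>0. infdist (x t) C \<le> \<beta> (infdist z C) t)"
    and r: "0 < r"
  shows "\<exists>\<Theta> M. \<forall>z. infdist z C \<in> {r..2*r} \<longrightarrow>
    (\<exists>\<tau> y u. descending_arc C f U r (\<beta> (2*r) 0 + r) \<Theta> M z \<tau> y u)"
proof -
  have beta_mono: "\<beta> a t \<le> \<beta> b t" if "0 \<le> a" "a \<le> b" "0 \<le> t" for a b t
  proof -
    have "strict_mono_on {0..} (\<lambda>r. \<beta> r t)" using KL that(3) by (simp add: KL_function_def)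
    then show ?thesis using that by (intro mono_onD[OF strict_mono_on_imp_mono_on, of "{0..}" "\<lambda>r. \<beta> r t"]) auto
  qed
  have beta_anti: "\<beta> a t \<le> \<beta> a 0" if "0 < a" "0 \<le> t" for a t
  proof (cases "t = 0")
    case False
    have "strict_antimono_on {0..} (\<beta> a)" using KL that(1) by (simp add: KL_function_def)
    then have "\<beta> a t < \<beta> a 0" using that False by (intro monotone_onD[of "{0..}" "(<)" "(>)" "\<beta> a" 0 t]) auto
    then show ?thesis by simp
  qed simp
  have "(\<beta> (2*r) \<longlongrightarrow> 0) at_top" using KL r by (simp add: KL_function_def)
  then have "\<forall>\<^sub>F t in at_top. \<beta> (2*r) t < r/2" by (rule order_tendstoD) (use r in simp)
  then obtain \<Theta> where "\<And>t. t \<ge> \<Theta> \<Longrightarrow> \<beta> (2*r) t < r/2" by (auto simp: eventually_at_top_linorder)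
  \<comment> \<open>The maximum with 1 makes the horizon positive.\<close>
  then have \<Theta>: "\<beta> (2*r) (max \<Theta> 1) < r/2" by simp
  let ?D = "\<lambda>M z \<tau> y u. descending_arc C f U r (\<beta> (2*r) 0 + r) (max \<Theta> 1) M z \<tau> y u"
  let ?R = "{z. infdist z C \<in> {r..2*r}}"
  have loc: "\<exists>d M. 0 < d \<and> (\<forall>z. norm (z - p) < d \<longrightarrow> (\<exists>\<tau> y u. ?D M z \<tau> y u))" if p: "p \<in> ?R" for p
  proof -
    have "p \<notin> C" using p r by auto
    then obtain T x u where adm: "admissible_pair C f U T x u" and x0: "x 0 = p"
      and xle: "\<And>t. t \<ge> 0 \<Longrightarrow> infdist (x t) C \<le> \<beta> (infdist p C) t"
      using traj by blast
    have T0: "T > 0" using adm by (simp add: admissible_pair_def)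
    have xle2: "infdist (x t) C \<le> \<beta> (2*r) t" if "t \<ge> 0" for t
      using xle[OF that] beta_mono[of "infdist p C" "2*r" t] that p by auto
    \<comment> \<open>Either the trajectory lives beyond the horizon and the rate applies there, or
      it reaches \<open>C\<close> at a time \<open>T\<close> no later than the horizon and is close
      to \<open>C\<close> shortly before \<open>T\<close>.\<close>
    have "\<exists>s>0. s \<le> max \<Theta> 1 \<and> ereal s < T \<and> infdist (x s) C \<le> r/2"
    proof (cases "ereal (max \<Theta> 1) < T")
      case True
      have "0 < max \<Theta> 1" by simp
      moreover from this have "infdist (x (max \<Theta> 1)) C \<le> r/2"
        using xle2[of "max \<Theta> 1"] \<Theta> by linarith
      ultimately show ?thesis using True by blast
    next
      case False
      then obtain T' where T': "T = ereal T'" "T' > 0" "T' \<le> max \<Theta> 1"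
        using T0 by (cases T) (auto simp del: ereal_max)
      have "((\<lambda>t. infdist (x t) C) \<longlongrightarrow> 0) (at_left T')"
        using adm T' by (auto simp: admissible_pair_def)
      then have "\<forall>\<^sub>F t in at_left T'. infdist (x t) C < r/2" by (rule order_tendstoD) (use r in simp)
      moreover have "\<forall>\<^sub>F t in at_left T'. t \<in> {0<..<T'}"
        using T' by (intro eventually_at_leftI[of 0]) auto
      ultimately have "\<forall>\<^sub>F t in at_left T'. infdist (x t) C < r/2 \<and> t \<in> {0<..<T'}" by (rule eventually_conj)
      then obtain s where "infdist (x s) C < r/2" "s \<in> {0<..<T'}"
        using eventually_happens trivial_limit_at_left_real by blast
      then show ?thesis using T' by (intro exI[of _ s]) auto
    qed
    then obtain s where s: "s > 0" "s \<le> max \<Theta> 1" "ereal s < T" "infdist (x s) C \<le> r/2" by blast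
    have "controlled_arc C f U 0 s x u \<or> True" by simp
    have contx: "continuous_on {0..s} x"
      using controlled_arc_of_admissible_pair[OF adm s(1,3)]
      by (metis absolutely_continuous_on_imp_continuous_on controlled_arc_def)
    obtain \<tau> where \<tau>: "0 < \<tau>" "\<tau> \<le> s" "infdist (x \<tau>) C = r/2" "\<And>t. t \<in> {0..\<tau>} \<Longrightarrow> r/2 \<le> infdist (x t) C"
    proof (rule first_hitting_time[of s "\<lambda>t. infdist (x t) C" "r/2"])
      show "continuous_on {0..s} (\<lambda>t. infdist (x t) C)" by (intro continuous_intros contx)
      show "r/2 < infdist (x 0) C" using p r by (auto simp: x0)
    qed (use s in auto)
    have "ereal \<tau> < T" using \<tau>(2) s(3) by (meson ereal_less_eq(3) le_less_trans)
    then obtain M where arc: "controlled_arc C f U M \<tau> x u"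
      using controlled_arc_of_admissible_pair[OF adm \<tau>(1)] by blast
    have "0 < r/4" using r by simp
    obtain d where d: "d > 0" "\<And>z. norm (z - x 0) < d \<Longrightarrow>
        \<exists>y. controlled_arc C f U M \<tau> y u \<and> y 0 = z \<and> (\<forall>t\<in>{0..\<tau>}. norm (y t - x t) \<le> r/4)"
      using perturb_controlled_arc[OF arc C(1) U cont lip \<open>0 < r/4\<close>] by blast
    show ?thesis
    proof (rule exI[of _ d], rule exI[of _ M], intro conjI allI impI)
      show "0 < d" by (rule d(1))
      fix z assume "norm (z - p) < d"
      then obtain y where y: "controlled_arc C f U M \<tau> y u" "y 0 = z" "\<And>t. t\<in>{0..\<tau>} \<Longrightarrow> norm (y t - x t) \<le> r/4"
        using d(2)[of z] x0 by auto
      have close: "\<bar>infdist (y t) C - infdist (x t) C\<bar> \<le> r/4" if "t \<in> {0..\<tau>}" for t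
        by (rule infdist_perturb[OF y(3)[OF that]])
      have "?D M z \<tau> y u"
        unfolding descending_arc_def
      proof (intro conjI ballI y(1,2))
        show "\<tau> \<le> max \<Theta> 1" using \<tau>(2) s(2) by simp
        have "\<bar>infdist (y \<tau>) C - infdist (x \<tau>) C\<bar> \<le> r/4" using close[of \<tau>] \<tau>(1) by simp
        then show "infdist (y \<tau>) C < r" using \<tau>(3) r by linarith
        fix t assume t: "t \<in> {0..\<tau>}"
        have "infdist (x t) C \<le> \<beta> (2*r) 0" using xle2[of t] beta_anti[of "2*r" t] t r by auto
        then show "infdist (y t) C \<in> {r/4..\<beta> (2*r) 0 + r}"
          using close[OF t] \<tau>(4)[OF t] r unfolding atLeastAtMost_iff by linarith
      qed
      then show "\<exists>\<tau> y u. ?D M z \<tau> y u" by blast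
    qed
  qed
  then obtain d M where dM: "\<And>p. p \<in> ?R \<Longrightarrow> 0 < d p"
    "\<And>p z. p \<in> ?R \<Longrightarrow> norm (z - p) < d p \<Longrightarrow> \<exists>\<tau> y u. ?D (M p) z \<tau> y u"
    by metis
  have "compact ?R" by (rule compact_infdist_annulus[OF C r])
  then obtain Q where Q: "finite Q" "Q \<subseteq> ?R" "?R \<subseteq> (\<Union>p\<in>Q. ball p (d p))"
    by (rule compactE_image[where C = ?R and f = "\<lambda>p. ball p (d p)"]) (use dM(1) in auto)
  \<comment> \<open>The element 0 is inserted because \<open>Q\<close> is empty if the annulus
    is.\<close>
  define M' where "M' = Max (insert 0 (M ` Q))"
  show ?thesis
  proof (rule exI[of _ "max \<Theta> 1"], rule exI[of _ M'], intro allI impI)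
    fix z assume "infdist z C \<in> {r..2*r}"
    then obtain p where p: "p \<in> Q" "z \<in> ball p (d p)" using Q(3) by blast
    then obtain \<tau> y u where D: "?D (M p) z \<tau> y u"
      using dM(2)[of p z] Q(2) by (auto simp: dist_norm norm_minus_commute)
    have "M p \<le> M'" using p Q(1) by (auto simp: M'_def)
    then show "\<exists>\<tau> y u. ?D M' z \<tau> y u"
      using D controlled_arc_mono unfolding descending_arc_def by blast
  qed
qed

section \<open>Concatenation of arcs\<close>

text \<open>Composing a Lebesgue measurable map with a continuous one may destroy measurability. A
  translation is harmless because it maps Lebesgue sets to Lebesgue sets.\<close>

lemma measurable_lebesgue_on_translation:
  fixes u :: "real \<Rightarrow> 'b::euclidean_space"
  assumes u: "u \<in> borel_measurable (lebesgue_on {0..l})"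
  shows "(\<lambda>t. u (t - c)) \<in> borel_measurable (lebesgue_on {c..c + l})"
proof -
  have "(\<lambda>t. t - c) \<in> lebesgue \<rightarrow>\<^sub>M lebesgue"
  proof (rule measurableI)
    fix A :: "real set" assume "A \<in> sets lebesgue"
    then have "(+) c ` A \<in> sets lebesgue" by (rule lebesgue_sets_translation)
    moreover have "(+) c ` A = (\<lambda>t. t - c) -` A" by (force simp: image_iff)
    ultimately show "(\<lambda>t. t - c) -` A \<inter> space lebesgue \<in> sets lebesgue" by simp
  qed simp
  then have "(\<lambda>t. t - c) \<in> lebesgue_on {c..c + l} \<rightarrow>\<^sub>M lebesgue_on {0..l}"
    by (intro measurable_restrict_space2 measurable_restrict_space1) (auto simp: space_restrict_space)
  from measurable_compose[OF this u] show ?thesis .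
qed

text \<open>Gluing is separated from the descent argument: of the levels, only ceilings
  \<open>b\<close> that tend to 0 are retained. The durations have no positive lower bound, so their
  sum may be finite.\<close>

locale arc_chain =
  fixes C :: "'a::euclidean_space set" and f :: "'a \<Rightarrow> 'b::euclidean_space \<Rightarrow> 'a" and U :: "'b set"
    and M \<tau> b :: "nat \<Rightarrow> real" and y :: "nat \<Rightarrow> real \<Rightarrow> 'a" and u :: "nat \<Rightarrow> real \<Rightarrow> 'b"
  assumes C: "closed C" "C \<noteq> {}" "compact (frontier C)"
    and arc: "\<And>n. controlled_arc C f U (M n) (\<tau> n) (y n) (u n)"
    and link: "\<And>n. y (Suc n) 0 = y n (\<tau> n)"
    and le_b: "\<And>n t. t \<in> {0..\<tau> n} \<Longrightarrow> infdist (y n t) C \<le> b n"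
    and b_lim: "b \<longlonglongrightarrow> 0"
begin

definition S :: "nat \<Rightarrow> real" where "S n = (\<Sum>i<n. \<tau> i)"
text \<open>The supremum is taken in the extended reals, so \<open>T\<close> is infinite exactly if
  the durations are not summable.\<close>

definition T :: ereal where "T = (SUP n. ereal (S n))"
text \<open>Pieces are half-open: a junction time belongs to the arc that starts there.\<close>

definition piece :: "real \<Rightarrow> nat" where "piece t = (LEAST n. t < S (Suc n))"
text \<open>A cluster point of the junction points \<open>y n 0\<close>. It is chosen once, whether
  \<open>T\<close> is finite or not, and is the resting point required by
  \<open>extended_beyond\<close>.\<close>

definition zbar :: 'a where
  "zbar = (SOME p. p \<in> frontier C \<and> (\<exists>r. strict_mono r \<and> (\<lambda>i. y (r i) 0) \<longlonglongrightarrow> p))"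
definition x :: "real \<Rightarrow> 'a" where
  "x t = (if ereal t < T then y (piece t) (t - S (piece t)) else zbar)"
definition v :: "real \<Rightarrow> 'b" where "v t = u (piece t) (t - S (piece t))"

section \<open>Junction times and the index of the current arc\<close>

lemma \<tau>_pos: "0 < \<tau> n"
  using arc[of n] by (simp add: controlled_arc_def)

lemma S_0 [simp]: "S 0 = 0" and S_Suc: "S (Suc n) = S n + \<tau> n"
  by (simp_all add: S_def)

lemma S_strict_mono: "strict_mono S"
  by (rule strict_monoI_Suc) (simp add: S_Suc \<tau>_pos)

lemma S_mono: "m \<le> n \<Longrightarrow> S m \<le> S n"
  using S_strict_mono by (simp add: strict_mono_less_eq)

lemma S_nonneg: "0 \<le> S n"
  using S_mono[of 0 n] by simp

lemma less_T_iff: "ereal t < T \<longleftrightarrow> (\<exists>n. t < S n)"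
  by (simp add: T_def less_SUP_iff)

lemma S_less_T: "ereal (S n) < T"
  unfolding less_T_iff using \<tau>_pos[of n] by (intro exI[of _ "Suc n"]) (simp add: S_Suc)

lemma T_pos: "0 < T"
  using S_less_T[of 0] by (simp add: zero_ereal_def)

lemma in_time_domain_iff: "t \<in> time_domain T \<longleftrightarrow> 0 \<le> t \<and> (\<exists>n. t < S n)"
  by (simp add: time_domain_def less_T_iff)

lemma piece_eq: "piece t = n" if "S n \<le> t" "t < S (Suc n)"
  unfolding piece_def
proof (rule Least_equality)
  show "t < S (Suc n)" by (rule that(2))
  fix m assume "t < S (Suc m)"
  with that(1) have "S n < S (Suc m)" by simp
  then show "n \<le> m" using S_strict_mono by (simp add: strict_mono_less)
qed

lemma piece_bounds:
  assumes "t \<in> time_domain T"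
  shows "S (piece t) \<le> t" "t < S (Suc (piece t))"
proof -
  obtain n where n: "t < S n" and t: "0 \<le> t" using assms in_time_domain_iff by auto
  have "\<exists>n. S n \<le> t \<and> t < S (Suc n)"
    using n
  proof (induction n)
    case (Suc n)
    then show ?case by (cases "t < S n") (auto simp: not_less)
  qed (use t in simp)
  then show "S (piece t) \<le> t" "t < S (Suc (piece t))" using piece_eq by auto
qed

lemma piece_time: "t - S (piece t) \<in> {0..\<tau> (piece t)}" if "t \<in> time_domain T"
  using piece_bounds[OF that] by (auto simp: S_Suc)

lemma piece_le: "n \<le> piece t" if "t \<in> time_domain T" "S n \<le> t"
proof -
  have "S n < S (Suc (piece t))" using that piece_bounds[of t] by simp
  then show ?thesis using S_strict_mono by (simp add: strict_mono_less)
qed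

lemma x_in: "x t = y (piece t) (t - S (piece t))" if "t \<in> time_domain T"
  using that by (simp add: x_def time_domain_def)

text \<open>The right endpoint already belongs to the next piece, where \<open>link\<close> makes
  both formulas agree. The closed interval is what the gluing of absolute continuity
  requires.\<close>

lemma x_eq: "x t = y n (t - S n)" if "t \<in> {S n..S (Suc n)}"
proof (cases "t = S (Suc n)")
  case True
  have "piece t = Suc n"
    using True by (intro piece_eq) (simp_all add: S_Suc[of "Suc n"] \<tau>_pos)
  then show ?thesis
    using True S_less_T[of "Suc n"] link[of n] by (simp add: x_def S_Suc)
next
  case False
  then have "piece t = n" using that by (intro piece_eq) auto
  moreover have "ereal t < T"
    unfolding less_T_iff using that False by (intro exI[of _ "Suc n"]) auto
  ultimately show ?thesis by (simp add: x_def)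
qed

lemma x_S: "x (S n) = y n 0"
  using x_eq[of "S n" n] S_mono[of n "Suc n"] by simp

lemma x_outside: "x t = zbar" if "0 \<le> t" "t \<notin> time_domain T"
  using that by (simp add: x_def time_domain_def)

lemma y_notin: "t \<in> {0..\<tau> n} \<Longrightarrow> y n t \<notin> C"
  using arc[of n] by (simp add: controlled_arc_def)

text \<open>Each junction point has a frontier point within its distance from \<open>C\<close>, and
  these distances tend to 0. A convergent subsequence of the frontier points, which exists by
  compactness, therefore drags the junction points to the same limit.\<close>

lemma zbar: "zbar \<in> frontier C" "\<exists>r. strict_mono r \<and> (\<lambda>i. y (r i) 0) \<longlonglongrightarrow> zbar"
proof -
  have "\<exists>p\<in>frontier C. dist (y n 0) p \<le> infdist (y n 0) C" for n
    using \<tau>_pos[of n] by (intro infdist_frontier_close[OF C(1,2)] y_notin) simp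
  then obtain p where p: "\<And>n. p n \<in> frontier C" "\<And>n. dist (y n 0) (p n) \<le> infdist (y n 0) C" by metis
  obtain q r where q: "q \<in> frontier C" "strict_mono r" "(p \<circ> r) \<longlonglongrightarrow> q"
    using C(3) p(1) unfolding compact_def by metis
  have "(\<lambda>n. dist (y n 0) (p n)) \<longlonglongrightarrow> 0"
  proof (rule tendsto_sandwich[OF _ _ tendsto_const b_lim])
    show "\<forall>\<^sub>F n in sequentially. dist (y n 0) (p n) \<le> b n"
      using p(2) le_b[of 0] \<tau>_pos by (intro always_eventually allI) (meson atLeastAtMost_iff less_imp_le order_refl order_trans)
  qed simp
  then have "(\<lambda>i. dist (y (r i) 0) (p (r i))) \<longlonglongrightarrow> 0"
    using LIMSEQ_subseq_LIMSEQ[OF _ q(2)] by (auto simp: o_def)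
  then have "(\<lambda>i. y (r i) 0 - p (r i)) \<longlonglongrightarrow> 0"
    by (simp add: dist_norm tendsto_norm_zero_iff)
  from tendsto_add[OF this q(3)[unfolded o_def]]
  have "(\<lambda>i. y (r i) 0) \<longlonglongrightarrow> q" by simp
  with q have "\<exists>p. p \<in> frontier C \<and> (\<exists>r. strict_mono r \<and> (\<lambda>i. y (r i) 0) \<longlonglongrightarrow> p)" by blast
  from someI_ex[OF this] show "zbar \<in> frontier C" "\<exists>r. strict_mono r \<and> (\<lambda>i. y (r i) 0) \<longlonglongrightarrow> zbar"
    by (auto simp: zbar_def)
qed

lemma infdist_zbar: "infdist zbar C = 0"
  using zbar(1) C(1) frontier_subset_closed by (intro infdist_zero) blast

section \<open>Regularity of the concatenated trajectory and control\<close>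

lemma in_time_domainI: "t \<in> time_domain T" if "0 \<le> t" "t \<le> S n"
  using that le_less_trans[of "ereal t" "ereal (S n)" T] S_less_T[of n] by (simp add: time_domain_def)

lemma absolutely_continuous_x: "absolutely_continuous_on {0..S n} x"
proof (induction n)
  case 0
  show ?case by (rule lipschitz_imp_absolutely_continuous_on[where L = 0]) simp
next
  case (Suc n)
  have "absolutely_continuous_on ((+) (S n) ` {0..\<tau> n}) (\<lambda>t. y n (t - S n))"
    using arc[of n] by (intro absolutely_continuous_on_translation) (simp add: controlled_arc_def)
  then have "absolutely_continuous_on {S n..S (Suc n)} (\<lambda>t. y n (t - S n))"
    by (simp add: S_Suc add.commute)
  then have "absolutely_continuous_on {S n..S (Suc n)} x"
    by (rule absolutely_continuous_on_cong) (rule x_eq)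
  with Suc show ?case by (rule absolutely_continuous_on_join)
qed

lemma v_measurable: "v \<in> borel_measurable (lebesgue_on (time_domain T))"
proof (rule measurable_piecewise_restrict[where C = "range (\<lambda>n. {S n..<S (Suc n)})"])
  fix \<Omega> assume "\<Omega> \<in> range (\<lambda>n. {S n..<S (Suc n)})"
  then obtain n where n: "\<Omega> = {S n..<S (Suc n)}" by auto
  have sub: "\<Omega> \<subseteq> time_domain T"
    using in_time_domainI[of _ "Suc n"] S_nonneg[of n] by (auto simp: n)
  show "\<Omega> \<inter> space (lebesgue_on (time_domain T)) \<in> sets (lebesgue_on (time_domain T))"
    unfolding sets_restrict_space by (auto simp: n space_restrict_space intro!: image_eqI[where x = \<Omega>])
  have "u n \<in> borel_measurable (lebesgue_on {0..\<tau> n})"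
    using arc[of n] by (simp add: controlled_arc_def)
  then have "(\<lambda>t. u n (t - S n)) \<in> borel_measurable (lebesgue_on {S n..S n + \<tau> n})"
    by (rule measurable_lebesgue_on_translation)
  then have "(\<lambda>t. u n (t - S n)) \<in> borel_measurable (lebesgue_on \<Omega>)"
    by (rule measurable_restrict_mono) (auto simp: n S_Suc)
  then have "v \<in> borel_measurable (lebesgue_on \<Omega>)"
    by (rule measurable_cong[THEN iffD1, rotated]) (auto simp: v_def n piece_eq)
  moreover have "restrict_space (lebesgue_on (time_domain T)) \<Omega> = lebesgue_on \<Omega>"
    using sub by (simp add: restrict_restrict_space time_domain_lebesgue n Int_absorb1)
  ultimately show "v \<in> borel_measurable (restrict_space (lebesgue_on (time_domain T)) \<Omega>)" by simp
next
  show "space (lebesgue_on (time_domain T)) \<subseteq> \<Union>(range (\<lambda>n. {S n..<S (Suc n)}))"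
    using piece_bounds by (force simp: space_restrict_space)
qed simp

text \<open>The bound is kept per arc, as \<open>M (piece t)\<close>. It yields local essential
  boundedness here and later the bound in terms of the distance from \<open>C\<close>.\<close>

lemma negligible_bad_control:
  "negligible {t\<in>time_domain T. \<not> (v t \<in> U \<and> norm (v t) \<le> M (piece t))}"
proof -
  let ?B = "\<lambda>n. {t\<in>{0..\<tau> n}. \<not> (u n t \<in> U \<and> norm (u n t) \<le> M n)}"
  have "negligible (?B n)" for n
    using arc[of n] unfolding controlled_arc_def by blast
  then have "negligible (\<Union>n. (+) (S n) ` ?B n)"
    by (intro negligible_countable_Union) (auto intro: negligible_translation)
  then show ?thesis
  proof (rule negligible_subset, clarify)
    fix t assume t: "t \<in> time_domain T" "\<not> (v t \<in> U \<and> norm (v t) \<le> M (piece t))"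
    then have "t - S (piece t) \<in> ?B (piece t)" using piece_time[OF t(1)] by (auto simp: v_def)
    then have "t \<in> (+) (S (piece t)) ` ?B (piece t)" by (intro image_eqI[where x = "t - S (piece t)"]) auto
    then show "t \<in> (\<Union>n. (+) (S n) ` ?B n)" by blast
  qed
qed

lemma negligible_bad_derivative:
  "negligible {t\<in>time_domain T. \<not> (x has_vector_derivative f (x t) (v t)) (at t within time_domain T)}"
proof -
  let ?B = "\<lambda>n. {t\<in>{0<..<\<tau> n}. \<not> (y n has_vector_derivative f (y n t) (u n t)) (at t)}"
  have "negligible (?B n)" for n
    using arc[of n] unfolding controlled_arc_def by blast
  \<comment> \<open>The junction times join the exceptional set, since the trajectory may have a
    corner there.\<close>
  then have neg: "negligible (\<Union>n. (+) (S n) ` ?B n \<union> {S n})"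
    by (intro negligible_countable_Union) (auto intro!: negligible_translation negligible_Un)
  show ?thesis
  proof (rule negligible_subset[OF neg], rule subsetI, rule ccontr)
    fix t assume "t \<in> {t\<in>time_domain T. \<not> (x has_vector_derivative f (x t) (v t)) (at t within time_domain T)}"
      and n: "t \<notin> (\<Union>n. (+) (S n) ` ?B n \<union> {S n})"
    then have t: "t \<in> time_domain T" and nd: "\<not> (x has_vector_derivative f (x t) (v t)) (at t within time_domain T)"
      by auto
    define n where "n = piece t"
    have tn: "S n < t" "t < S (Suc n)"
    proof -
      have "t \<noteq> S n" using n by blast
      then show "S n < t" using piece_bounds(1)[OF t] by (simp add: n_def)
      show "t < S (Suc n)" using piece_bounds(2)[OF t] by (simp add: n_def)
    qed
    have "t - S n \<notin> ?B n"
    proof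
      assume "t - S n \<in> ?B n"
      then have "t \<in> (+) (S n) ` ?B n" by (intro image_eqI[where x = "t - S n"]) auto
      with n show False by blast
    qed
    then have D: "(y n has_vector_derivative f (y n (t - S n)) (u n (t - S n))) (at (t - S n))"
      using tn by (auto simp: S_Suc)
    have "((\<lambda>t. t - S n) has_vector_derivative 1) (at t)"
      by (auto intro!: derivative_eq_intros)
    from vector_diff_chain_at[OF this D]
    have "((\<lambda>t. y n (t - S n)) has_vector_derivative f (x t) (v t)) (at t)"
      using x_in[OF t] by (simp add: o_def v_def n_def)
    then have "(x has_vector_derivative f (x t) (v t)) (at t)"
      by (rule has_vector_derivative_transform_within_open[where S = "{S n<..<S (Suc n)}"])
         (use tn x_eq[of _ n] in auto)
    with nd show False using has_vector_derivative_at_within by blast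
  qed
qed

lemma x_infdist_le: "infdist (x t) C \<le> b (piece t)" if "t \<in> time_domain T"
  using le_b[OF piece_time[OF that]] x_in[OF that] by simp

text \<open>A compact subset of the time domain has a maximum, which lies below some
  \<open>S n\<close>. It thus meets only finitely many arcs, and the largest of their bounds
  serves.\<close>

lemma v_Linf_loc: "v \<in> Linf_loc (time_domain T) U"
  unfolding Linf_loc_def
proof (intro CollectI conjI allI impI v_measurable)
  show "AE t in lebesgue_on (time_domain T). v t \<in> U"
    unfolding AE_lebesgue_on_iff_negligible[OF time_domain_lebesgue]
    by (rule negligible_subset[OF negligible_bad_control]) auto
  fix K assume K: "compact K \<and> K \<subseteq> time_domain T"
  show "\<exists>m. AE t in lebesgue_on K. norm (v t) \<le> m"
  proof (cases "K = {}")
    case True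
    have "AE t in lebesgue_on K. norm (v t) \<le> 0"
      using True by (subst AE_lebesgue_on_iff_negligible) auto
    then show ?thesis by blast
  next
    case False
    then obtain m where m: "m \<in> K" "\<And>t. t \<in> K \<Longrightarrow> t \<le> m"
      using K compact_attains_sup[of K] by blast
    then obtain n where n: "m < S n" using K in_time_domain_iff by blast
    let ?m = "Max (M ` {..n})"
    have le: "M (piece t) \<le> ?m" if "t \<in> K" for t
    proof -
      have "S (piece t) < S n" using piece_bounds[of t] K m(2)[OF that] n that by fastforce
      then have "piece t < n" using S_strict_mono by (simp add: strict_mono_less)
      then show ?thesis by (intro Max_ge) auto
    qed
    have "negligible {t\<in>K. \<not> norm (v t) \<le> ?m}"
      by (rule negligible_subset[OF negligible_bad_control]) (use K le in \<open>auto intro: order_trans\<close>)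
    moreover have "K \<in> sets lebesgue" using K by (simp add: lmeasurable_compact fmeasurableD)
    ultimately show ?thesis by (auto simp: AE_lebesgue_on_iff_negligible)
  qed
qed

section \<open>Behaviour at the end of the time domain\<close>

lemma x_limit:
  assumes "T < \<infinity>"
  shows "((\<lambda>t. infdist (x t) C) \<longlongrightarrow> 0) (at_left (real_of_ereal T))"
proof (rule tendstoI)
  fix e :: real assume "e > 0"
  then have "\<forall>\<^sub>F n in sequentially. b n < e" using b_lim by (intro order_tendstoD)
  then obtain n where n: "\<And>m. n \<le> m \<Longrightarrow> b m < e" by (auto simp: eventually_sequentially)
  obtain T' where T': "T = ereal T'" using assms T_pos by (cases T) auto
  have "dist (infdist (x t) C) 0 < e" if t: "t \<in> {S n<..<T'}" for t
  proof -
    have "t \<in> time_domain T" using t S_nonneg[of n] by (auto simp: time_domain_def T')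
    then show ?thesis
      using x_infdist_le[of t] n[OF piece_le[of t n]] t by (auto simp: infdist_nonneg)
  qed
  moreover have "S n < T'" using S_less_T[of n] T' by simp
  ultimately show "\<forall>\<^sub>F t in at_left (real_of_ereal T). dist (infdist (x t) C) 0 < e"
    unfolding T' by (intro eventually_at_leftI[of "S n"]) auto
qed

lemma admissible: "admissible_pair C f U T x v"
  unfolding admissible_pair_def
proof (intro conjI impI ballI)
  show "0 < T" by (rule T_pos)
  show "v \<in> Linf_loc (time_domain T) U" by (rule v_Linf_loc)
  show "x t \<notin> C" if "t \<in> time_domain T" for t
    using y_notin[OF piece_time[OF that]] x_in[OF that] by simp
  show "locally_absolutely_continuous_on (time_domain T) x"
    unfolding locally_absolutely_continuous_on_def
  proof (intro allI impI)
    fix c d assume cd: "{c..d} \<subseteq> time_domain T"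
    have "\<exists>n. {c..d} \<subseteq> {0..S n}"
    proof (cases "c \<le> d")
      case True
      then have "c \<in> time_domain T" "d \<in> time_domain T" using cd by auto
      then obtain n where "0 \<le> c" "d < S n" using in_time_domain_iff by blast
      then show ?thesis by (intro exI[of _ n]) auto
    qed auto
    then show "absolutely_continuous_on {c..d} x"
      using absolutely_continuous_on_subset[OF absolutely_continuous_x] by blast
  qed
  show "AE t in lebesgue_on (time_domain T).
     (x has_vector_derivative f (x t) (v t)) (at t within time_domain T)"
    unfolding AE_lebesgue_on_iff_negligible[OF time_domain_lebesgue] by (rule negligible_bad_derivative)
qed (rule x_limit)

lemma extended: "extended_beyond C T x"
  unfolding extended_beyond_def
proof
  assume "T < \<infinity>"
  then obtain T' where T': "T = ereal T'" using T_pos by (cases T) auto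
  obtain r where r: "strict_mono r" "(\<lambda>i. y (r i) 0) \<longlonglongrightarrow> zbar" using zbar(2) by blast
  have "(\<lambda>n. ereal (S n)) \<longlonglongrightarrow> T"
    unfolding T_def by (rule LIMSEQ_SUP) (auto simp: incseq_def S_mono)
  then have "S \<longlonglongrightarrow> T'" by (simp add: T')
  then have lim: "(\<lambda>i. S (r i)) \<longlonglongrightarrow> T'" using LIMSEQ_subseq_LIMSEQ[OF _ r(1)] by (auto simp: o_def)
  show "\<exists>zbar\<in>frontier C.
       (\<exists>\<tau>. range \<tau> \<subseteq> time_domain T \<and> incseq \<tau> \<and> \<tau> \<longlonglongrightarrow> real_of_ereal T \<and> (\<lambda>i. x (\<tau> i)) \<longlonglongrightarrow> zbar) \<and>
       (\<forall>t\<ge>real_of_ereal T. x t = zbar)"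
  proof (intro bexI[OF _ zbar(1)] conjI exI[of _ "\<lambda>i. S (r i)"] allI impI)
    show "range (\<lambda>i. S (r i)) \<subseteq> time_domain T" using S_nonneg in_time_domainI by blast
    show "incseq (\<lambda>i. S (r i))" using r(1) by (auto simp: incseq_def strict_mono_less_eq intro!: S_mono)
    show "(\<lambda>i. S (r i)) \<longlonglongrightarrow> real_of_ereal T" using lim by (simp add: T')
    show "(\<lambda>i. x (S (r i))) \<longlonglongrightarrow> zbar" using r(2) by (simp add: x_S)
    show "x t = zbar" if "real_of_ereal T \<le> t" for t using that by (simp add: x_def T')
  qed
qed

end

section \<open>Descent rates and control bounds from level data\<close>

text \<open>The function is the supremum of 0 and of those \<open>F k\<close> whose condition
  \<open>P k\<close> is met at \<open>r\<close>; the more conditions are met as \<open>r\<close>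
  grows, the larger it becomes. The last clause expresses minimality, from which limits at 0 are
  derived.\<close>

lemma Sup_threshold:
  fixes F :: "int \<Rightarrow> real" and P :: "int \<Rightarrow> real \<Rightarrow> bool"
  assumes mono: "\<forall>k. \<forall>r>0. \<forall>s\<ge>r. P k r \<longrightarrow> P k s"
    and bdd: "\<forall>r>0. bdd_above (F ` {k. P k r})"
  shows "\<exists>h. mono_on {0<..} h \<and> (\<forall>r>0. 0 \<le> h r) \<and> (\<forall>k. \<forall>r>0. P k r \<longrightarrow> F k \<le> h r) \<and>
    (\<forall>c\<ge>0. \<forall>r. (\<forall>k. P k r \<longrightarrow> F k \<le> c) \<longrightarrow> h r \<le> c)"
proof -
  define h where "h = (\<lambda>r. Sup (insert 0 (F ` {k. P k r})))"
  have bdd': "bdd_above (insert 0 (F ` {k. P k r}))" if "0 < r" for r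
    using bdd[rule_format, OF that] by simp
  have h1: "mono_on {0<..} h"
  proof (rule mono_onI)
    fix r s :: real assume rs: "r \<in> {0<..}" "s \<in> {0<..}" "r \<le> s"
    have "insert 0 (F ` {k. P k r}) \<subseteq> insert 0 (F ` {k. P k s})" using mono[rule_format, of r s] rs by blast
    then show "h r \<le> h s"
      unfolding h_def using rs bdd'[of s] by (intro cSup_subset_mono) auto
  qed
  have h2: "0 \<le> h r" if "0 < r" for r
    unfolding h_def by (rule cSup_upper[OF _ bdd'[OF that]]) simp
  have h3: "F k \<le> h r" if "0 < r" "P k r" for k r
    unfolding h_def by (rule cSup_upper[OF _ bdd'[OF that(1)]]) (use that in simp)
  have h4: "h r \<le> c" if "0 \<le> c" "\<forall>k. P k r \<longrightarrow> F k \<le> c" for c r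
    unfolding h_def by (rule cSup_least) (use that in auto)
  show ?thesis
  proof (intro exI[of _ h] conjI)
    show "\<forall>c\<ge>0. \<forall>r. (\<forall>k. P k r \<longrightarrow> F k \<le> c) \<longrightarrow> h r \<le> c" using h4 by blast
  qed (use h1 h2 h3 in auto)
qed

text \<open>A discrete antiderivative of \<open>\<Theta>\<close> on the integers, normalised to 0 at
  0. Increments of at least 1 drive it to both infinities at least linearly.\<close>

lemma two_sided_partial_sums:
  fixes \<Theta> :: "int \<Rightarrow> real"
  assumes "\<And>k. 1 \<le> \<Theta> k"
  obtains s :: "int \<Rightarrow> real" where "\<And>k. s k = s (k - 1) + \<Theta> k" "\<And>k. k \<le> 0 \<Longrightarrow> s k \<le> k" "\<And>k. 0 \<le> k \<Longrightarrow> k \<le> s k"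
proof -
  define s where "s k = (\<Sum>i\<in>{1..k}. \<Theta> i) - (\<Sum>i\<in>{k+1..0}. \<Theta> i)" for k
  have rec: "s k = s (k - 1) + \<Theta> k" for k
  proof (cases "k \<ge> 1")
    case True
    then have "{1..k} = insert k {1..k - 1}" "{k+1..0} = {}" "{k - 1 + 1..0} = {}" by auto
    then show ?thesis by (simp add: s_def)
  next
    case False
    then have "{1..k} = {}" "{1..k - 1} = {}" "{k - 1 + 1..0} = insert k {k+1..0}" by auto
    then show ?thesis by (simp add: s_def)
  qed
  have "(\<Sum>i\<in>A. 1) \<le> (\<Sum>i\<in>A. \<Theta> i)" for A by (rule sum_mono) (rule assms)
  then have card: "real (card A) \<le> (\<Sum>i\<in>A. \<Theta> i)" for A by simp
  have "s k \<le> k" if "k \<le> 0" for k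
    using card[of "{k+1..0}"] that by (simp add: s_def)
  moreover have "k \<le> s k" if "0 \<le> k" for k
    using card[of "{1..k}"] that by (simp add: s_def)
  ultimately show thesis using rec that by blast
qed

text \<open>
  The logarithm of \<open>a k\<close> is a clock that advances by at least \<open>\<Theta> k\<close> between the levels \<open>k - 1\<close>
  and \<open>k\<close>: descending through level \<open>k\<close> within time \<open>\<Theta> k\<close> is then paid for by a factor \<open>exp (- \<Theta> k)\<close>.
\<close>

lemma K_infinity_rates:
  fixes \<Theta> B :: "int \<Rightarrow> real"
  assumes B_mono: "mono B" and B_nonneg: "\<And>k. 0 \<le> B k" and B_lim: "(B \<longlongrightarrow> 0) at_bot"
  obtains a G \<alpha> where "K_infinity G" "K_infinity \<alpha>" "\<And>k. 0 < a k" "mono a"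
    "\<And>k. a (k - 1) * exp (\<Theta> k) \<le> a k" "\<And>k. B k \<le> G (a (k - 1))"
    "\<And>r. 0 < r \<Longrightarrow> a \<lfloor>log 2 r\<rfloor> \<le> \<alpha> r"
proof -
  \<comment> \<open>Raising the increments to at least 1 makes \<open>a\<close> tend to 0 towards
    negative indices and to infinity towards positive ones, even if the \<open>\<Theta> k\<close>
    are small or summable.\<close>
  obtain s where s: "\<And>k. s k = s (k - 1) + max 1 (\<Theta> k)"
    "\<And>k. k \<le> 0 \<Longrightarrow> s k \<le> k" "\<And>k. 0 \<le> k \<Longrightarrow> k \<le> s k"
    using two_sided_partial_sums[of "\<lambda>k. max 1 (\<Theta> k)"] by (metis max.cobounded1)
  define a where "a k = exp (s k)" for k
  have a_pos: "0 < a k" for k by (simp add: a_def)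
  have a_step: "a (k - 1) * exp (\<Theta> k) \<le> a k" for k
    unfolding a_def exp_add[symmetric] using s(1)[of k] by simp
  have s_mono: "s j \<le> s k" if "j \<le> k" for j k
    using that
  proof (induction k rule: int_ge_induct)
    case (step i)
    then show ?case using s(1)[of "i + 1"] by simp
  qed simp
  have a_mono: "mono a" by (auto intro!: monoI simp: a_def s_mono)
  have s_strict: "j < k" if "s j < s k" for j k
    using s_mono[of k j] that by (cases "j < k") auto
  have a_small: "\<exists>K. a K < e" if "0 < e" for e
  proof -
    define K where "K = min 0 (\<lfloor>ln e\<rfloor> - 1)"
    have "s K < ln e" using s(2)[of K] unfolding K_def by linarith
    then have "a K < e" using that by (simp add: a_def ln_less_cancel_iff[symmetric] del: ln_less_cancel_iff)
    then show ?thesis by blast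
  qed
  have bddG: "bdd_above (B ` {k. a (k - 1) \<le> r})" if r: "0 < r" for r
  proof (rule bdd_aboveI2)
    fix k assume "k \<in> {k. a (k - 1) \<le> r}"
    then have "s (k - 1) \<le> ln r" using r by (simp add: a_def ln_ge_iff)
    then have "k \<le> max 1 (\<lceil>ln r\<rceil> + 1)" using s(3)[of "k - 1"] by linarith
    then show "B k \<le> B (max 1 (\<lceil>ln r\<rceil> + 1))" by (rule monoD[OF B_mono])
  qed
  \<comment> \<open>The height \<open>B k\<close> has to be allowed until the end of an arc of level
    \<open>k\<close>, when the argument of \<open>G\<close> is only known to be at least
    \<open>a (k - 1)\<close>. This is the reason for the shift of the index.\<close>
  obtain hG where "mono_on {0<..} hG \<and> (\<forall>r>0. 0 \<le> hG r) \<and> (\<forall>k. \<forall>r>0. a (k - 1) \<le> r \<longrightarrow> B k \<le> hG r) \<and>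
    (\<forall>c\<ge>0. \<forall>r. (\<forall>k. a (k - 1) \<le> r \<longrightarrow> B k \<le> c) \<longrightarrow> hG r \<le> c)"
    using Sup_threshold[of "\<lambda>k r. a (k - 1) \<le> r" B] bddG by auto
  then have G: "mono_on {0<..} hG" "\<And>r. 0 < r \<Longrightarrow> 0 \<le> hG r"
    "\<And>k r. 0 < r \<Longrightarrow> a (k - 1) \<le> r \<Longrightarrow> B k \<le> hG r"
    "\<And>c r. 0 \<le> c \<Longrightarrow> (\<And>k. a (k - 1) \<le> r \<Longrightarrow> B k \<le> c) \<Longrightarrow> hG r \<le> c"
    by simp_all
  have "(hG \<longlongrightarrow> 0) (at_right 0)"
  proof (rule tendstoI)
    fix e :: real assume e: "0 < e"
    then have "\<forall>\<^sub>F k in at_bot. B k < e/2" using B_lim by (intro order_tendstoD) auto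
    then obtain K where K: "\<And>k. k \<le> K \<Longrightarrow> B k < e/2" by (auto simp: eventually_at_bot_linorder)
    have "hG r \<le> e/2" if "r \<in> {0<..<a K}" for r
    proof (rule G(4))
      fix k assume "a (k - 1) \<le> r"
      with that have "s (k - 1) < s K" by (simp add: a_def) (metis exp_less_cancel_iff le_less_trans)
      then have "k \<le> K" using s_strict by fastforce
      then show "B k \<le> e/2" using K by (simp add: less_imp_le)
    qed (use e in simp)
    then have "dist (hG r) 0 < e" if "r \<in> {0<..<a K}" for r
      using that G(2)[of r] e by fastforce
    then show "\<forall>\<^sub>F r in at_right 0. dist (hG r) 0 < e"
      by (intro eventually_at_rightI[of 0 "a K"]) (auto simp: a_pos)
  qed
  then obtain g where g: "K_infinity g" "\<And>r. r > 0 \<Longrightarrow> hG r \<le> g r"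
    using K_infinity_majorant[OF G(1,2)] by blast
  define hA where "hA r = a \<lfloor>log 2 r\<rfloor>" for r
  have "mono_on {0<..} hA"
    unfolding hA_def by (intro mono_onI monoD[OF a_mono] floor_mono) simp
  moreover have "\<And>r. 0 < r \<Longrightarrow> 0 \<le> hA r" using a_pos by (simp add: hA_def less_imp_le)
  moreover have "(hA \<longlongrightarrow> 0) (at_right 0)"
  proof (rule tendstoI)
    fix e :: real assume "0 < e"
    then obtain K where K: "a K < e" using a_small by blast
    have "dist (hA r) 0 < e" if "r \<in> {0<..<2 powr K}" for r
    proof -
      have "log 2 r < K" using that by (simp add: log_less_iff)
      then have "\<lfloor>log 2 r\<rfloor> \<le> K" by linarith
      then have "hA r \<le> a K" unfolding hA_def by (rule monoD[OF a_mono])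
      then show ?thesis using K a_pos[of "\<lfloor>log 2 r\<rfloor>"] by (simp add: hA_def)
    qed
    then show "\<forall>\<^sub>F r in at_right 0. dist (hA r) 0 < e"
      by (intro eventually_at_rightI[of 0 "2 powr K"]) auto
  qed
  ultimately obtain \<alpha> where \<alpha>: "K_infinity \<alpha>" "\<And>r. r > 0 \<Longrightarrow> hA r \<le> \<alpha> r"
    using K_infinity_majorant by blast
  show thesis
  proof (rule that[OF g(1) \<alpha>(1) a_pos a_mono a_step])
    show "B k \<le> g (a (k - 1))" for k
      using G(3)[OF a_pos, of k "k - 1"] g(2)[OF a_pos, of "k - 1"] by simp
    show "a \<lfloor>log 2 r\<rfloor> \<le> \<alpha> r" if "0 < r" for r using \<alpha>(2)[OF that] by (simp add: hA_def)
  qed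
qed

text \<open>No monotonicity of \<open>M\<close> is available, so the indices are split by sign. For
  \<open>k \<ge> 0\<close> the lower threshold \<open>2 powr k / 4\<close> leaves finitely many
  indices at a given \<open>r\<close> and an envelope increasing in \<open>r\<close>. For
  \<open>k < 0\<close> the decay of \<open>B\<close> leaves finitely many and an envelope decreasing
  in \<open>r\<close>, which becomes increasing in the variable \<open>q = 1 / r\<close>. Both have
  continuous majorants, and the sum of these is \<open>\<sigma>\<close>.\<close>

lemma locally_finite_control_bound:
  fixes M B :: "int \<Rightarrow> real"
  assumes B_lim: "(B \<longlongrightarrow> 0) at_bot"
  obtains \<sigma> :: "real \<Rightarrow> real" where "continuous_on {0<..} \<sigma>" "\<And>r. 0 < r \<Longrightarrow> 0 < \<sigma> r"
    "\<And>k r. 0 < r \<Longrightarrow> 2 powr k / 4 \<le> r \<Longrightarrow> r \<le> B k \<Longrightarrow> M k \<le> \<sigma> r"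
proof -
  define P where "P k r \<longleftrightarrow> 0 \<le> k \<and> 2 powr k / 4 \<le> r" for k :: int and r :: real
  define Q where "Q k q \<longleftrightarrow> k < 0 \<and> 1 / q \<le> B k" for k :: int and q :: real
  have "finite {k. P k r}" if "0 < r" for r
  proof (rule finite_subset)
    show "{k. P k r} \<subseteq> {0..\<lceil>log 2 (4 * r)\<rceil>}"
    proof clarify
      fix k assume "P k r"
      then have "0 \<le> k" "2 powr k \<le> 4 * r" by (auto simp: P_def)
      then show "k \<in> {0..\<lceil>log 2 (4 * r)\<rceil>}" using that by (simp add: le_log_iff[symmetric]) linarith
    qed
  qed simp
  then have bddP: "\<forall>r>0. bdd_above (M ` {k. P k r})" by simp
  have "finite {k. Q k q}" if q: "0 < q" for q
  proof -
    have "\<forall>\<^sub>F k in at_bot. B k < 1 / q" using B_lim q by (intro order_tendstoD) auto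
    then obtain K where K: "\<And>k. k \<le> K \<Longrightarrow> B k < 1 / q" by (auto simp: eventually_at_bot_linorder)
    have "{k. Q k q} \<subseteq> {K..0}"
    proof clarify
      fix k assume "Q k q"
      then show "k \<in> {K..0}" using K[of k] by (cases "k \<le> K") (auto simp: Q_def)
    qed
    then show ?thesis by (rule finite_subset) simp
  qed
  then have bddQ: "\<forall>r>0. bdd_above (M ` {k. Q k r})" by simp
  have P_mono: "\<forall>k. \<forall>r>0. \<forall>s\<ge>r. P k r \<longrightarrow> P k s" by (auto simp: P_def)
  have "Q k s" if "0 < r" "r \<le> s" "Q k r" for k r s
    using that frac_le[of 1 1 r s] by (auto simp: Q_def)
  then have Q_mono: "\<forall>k. \<forall>r>0. \<forall>s\<ge>r. Q k r \<longrightarrow> Q k s" by blast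
  obtain hP where hP: "mono_on {0<..} hP" "\<And>r. 0 < r \<Longrightarrow> 0 \<le> hP r" "\<And>k r. 0 < r \<Longrightarrow> P k r \<Longrightarrow> M k \<le> hP r"
    using Sup_threshold[of P M, OF P_mono bddP] by blast
  obtain hQ where hQ: "mono_on {0<..} hQ" "\<And>r. 0 < r \<Longrightarrow> 0 \<le> hQ r" "\<And>k r. 0 < r \<Longrightarrow> Q k r \<Longrightarrow> M k \<le> hQ r"
    using Sup_threshold[of Q M, OF Q_mono bddQ] by blast
  obtain g where g: "continuous_on {0<..} g" "\<And>r. r > 0 \<Longrightarrow> r + hP r \<le> g r"
    by (rule continuous_majorant_of_monotone[OF hP(1)]) (assumption | rule that)+
  obtain g' where g': "continuous_on {0<..} g'" "\<And>r. r > 0 \<Longrightarrow> r + hQ r \<le> g' r"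
    by (rule continuous_majorant_of_monotone[OF hQ(1)]) (assumption | rule that)+
  show thesis
  proof (rule that)
    show "continuous_on {0<..} (\<lambda>r. g r + g' (1 / r))"
      by (intro continuous_intros g(1) continuous_on_compose2[OF g'(1)]) auto
    have *: "r + hP r \<le> g r" "1 / r + hQ (1 / r) \<le> g' (1 / r)" "0 \<le> hP r" "0 \<le> hQ (1 / r)" "0 < 1 / r"
      if "0 < r" for r
      using g(2)[of r] g'(2)[of "1 / r"] hP(2)[of r] hQ(2)[of "1 / r"] that by auto
    show "0 < g r + g' (1 / r)" if "0 < r" for r
      using *[OF that] that by linarith
    fix k :: int and r :: real assume r: "0 < r" "2 powr k / 4 \<le> r" "r \<le> B k"
    show "M k \<le> g r + g' (1 / r)"
    proof (cases "0 \<le> k")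
      case True
      then have "M k \<le> hP r" using r by (intro hP(3)) (auto simp: P_def)
      then show ?thesis using *[OF r(1)] r(1) by linarith
    next
      case False
      then have "M k \<le> hQ (1 / r)" using r by (intro hQ(3)) (auto simp: Q_def)
      then show ?thesis using *[OF r(1)] r(1) by linarith
    qed
  qed
qed

section \<open>Globally asymptotically controllable systems\<close>

text \<open>What is kept of the hypothesis are three sequences indexed by level: ceilings
  \<open>B\<close>, durations \<open>\<Theta>\<close> and control bounds \<open>M\<close>. The first
  two determine the new rate, the first and the third determine \<open>\<sigma>\<close>. Both are
  fixed before any starting point is considered.\<close>

lemma GAC_imp_GAC_controls:
  fixes C :: "'a::euclidean_space set" and U :: "'b::euclidean_space set"
  assumes C: "closed C" "C \<noteq> {}" "compact (frontier C)" and U: "closed U"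
    and cont: "continuous_on ((- C) \<times> U) (\<lambda>(x, u). f x u)"
    and lip: "\<And>K U1. compact K \<Longrightarrow> K \<subseteq> - C \<Longrightarrow> compact U1 \<Longrightarrow> U1 \<subseteq> U \<Longrightarrow>
           \<exists>L>0. \<forall>x\<in>K. \<forall>y\<in>K. \<forall>u\<in>U1. norm (f x u - f y u) \<le> L * norm (x - y)"
    and GAC: "GAC C f U"
  shows "\<exists>\<sigma>::real \<Rightarrow> real. continuous_on {0<..} \<sigma> \<and> (\<forall>r>0. \<sigma> r > 0) \<and> GAC_controls C f U \<sigma>"
proof -
  obtain \<beta> where KL: "KL_function \<beta>"
    and traj: "\<And>z. z \<notin> C \<Longrightarrow> \<exists>T x u. admissible_pair C f U T x u \<and> x 0 = z \<and>
          (\<forall>t\<ge>0. infdist (x t) C \<le> \<beta> (infdist z C) t)"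
    using GAC unfolding GAC_def by meson
  define r where "r k = 2 powr real_of_int k" for k :: int
  define B where "B k = \<beta> (2 * r k) 0 + r k" for k
  define \<kappa> where "\<kappa> z = \<lfloor>log 2 (infdist z C)\<rfloor>" for z :: 'a
  have r_pos: "0 < r k" for k by (simp add: r_def)
  have r_mono: "r j \<le> r k" if "j \<le> k" for j k using that by (simp add: r_def)
  have r_lim: "(r \<longlongrightarrow> 0) at_bot"
  proof -
    have "((\<lambda>k. exp (real_of_int k * ln 2)) \<longlongrightarrow> 0) at_bot"
    proof (rule tendstoI)
      fix e :: real assume e: "0 < e"
      have "exp (real_of_int k * ln 2) < e" if "k \<le> \<lfloor>ln e / ln 2\<rfloor> - 1" for k
      proof -
        have "real_of_int k < ln e / ln 2" using that by linarith
        then have "real_of_int k * ln 2 < ln e" by (simp add: field_simps)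
        then show ?thesis using e by (metis exp_less_cancel_iff exp_ln)
      qed
      then show "\<forall>\<^sub>F k in at_bot. dist (exp (real_of_int k * ln 2)) 0 < e"
        unfolding eventually_at_bot_linorder by (intro exI[of _ "\<lfloor>ln e / ln 2\<rfloor> - 1"]) auto
    qed
    then show ?thesis by (simp add: r_def[abs_def] powr_def mult.commute)
  qed
  have \<beta>0: "continuous_on {0..} (\<lambda>r. \<beta> r 0)" "strict_mono_on {0..} (\<lambda>r. \<beta> r 0)" "\<beta> 0 0 = 0"
    "\<And>r. 0 \<le> r \<Longrightarrow> 0 \<le> \<beta> r 0"
  proof -
    have "continuous_on ({0..} \<times> {0..}) (\<lambda>(r, t). \<beta> r t)" using KL by (simp add: KL_function_def)
    then have "continuous_on {0..} (\<lambda>r. (\<lambda>(r, t). \<beta> r t) (r, 0))"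
      by (rule continuous_on_compose2) (auto intro!: continuous_intros)
    then show "continuous_on {0..} (\<lambda>r. \<beta> r 0)" by simp
    show "strict_mono_on {0..} (\<lambda>r. \<beta> r 0)" "\<beta> 0 0 = 0" "\<And>r. 0 \<le> r \<Longrightarrow> 0 \<le> \<beta> r 0"
      using KL by (simp_all add: KL_function_def)
  qed
  have B_mono: "mono B"
  proof (rule monoI)
    fix j k :: int assume "j \<le> k"
    then have "\<beta> (2 * r j) 0 \<le> \<beta> (2 * r k) 0"
      using r_mono[of j k] r_pos[of j]
      by (intro mono_onD[OF strict_mono_on_imp_mono_on[OF \<beta>0(2)]]) auto
    then show "B j \<le> B k" using r_mono[OF \<open>j \<le> k\<close>] by (simp add: B_def)
  qed
  have B_nonneg: "0 \<le> B k" for k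
    using \<beta>0(4)[of "2 * r k"] r_pos[of k] by (simp add: B_def)
  have B_lim: "(B \<longlongrightarrow> 0) at_bot"
  proof -
    have "((\<lambda>k. 2 * r k) \<longlongrightarrow> 2 * 0) at_bot" by (intro tendsto_intros r_lim)
    then have "((\<lambda>k. 2 * r k) \<longlongrightarrow> 0) at_bot" by simp
    moreover have "\<forall>\<^sub>F k in at_bot. 2 * r k \<in> {0..}" using r_pos by (simp add: less_imp_le)
    ultimately have "((\<lambda>k. \<beta> (2 * r k) 0) \<longlongrightarrow> \<beta> 0 0) at_bot"
      by (intro continuous_on_tendsto_compose[OF \<beta>0(1)]) auto
    from tendsto_add[OF this r_lim] show ?thesis by (simp add: B_def[abs_def] \<beta>0(3))
  qed
  have "\<exists>\<Theta> M. \<forall>z. infdist z C \<in> {r k..2 * r k} \<longrightarrow>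
      (\<exists>\<tau> y u. descending_arc C f U (r k) (B k) \<Theta> M z \<tau> y u)" for k
    unfolding B_def using GAC_uniform_descent[OF C U cont lip KL traj r_pos] by simp
  then obtain \<Theta> M where desc: "\<And>k z. infdist z C \<in> {r k..2 * r k} \<Longrightarrow>
      \<exists>\<tau> y u. descending_arc C f U (r k) (B k) (\<Theta> k) (M k) z \<tau> y u"
    by metis
  have pos: "0 < infdist z C" if "z \<notin> C" for z
    using that C by (metis in_closed_iff_infdist_zero infdist_nonneg less_le)
  have ring: "infdist z C \<in> {r (\<kappa> z)..2 * r (\<kappa> z)}" if "z \<notin> C" for z
  proof -
    have "2 powr \<kappa> z \<le> infdist z C \<and> infdist z C < 2 powr (\<kappa> z + 1)"
      using floor_log_eq_powr_iff[OF pos[OF that], of 2 "\<kappa> z"] by (simp add: \<kappa>_def)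
    then show ?thesis by (simp add: r_def powr_add)
  qed
  \<comment> \<open>The arc is chosen as a function of its starting point, so that the sequence of
    junctions is simply an orbit of the endpoint map.\<close>
  have "\<exists>\<tau> y u. z \<notin> C \<longrightarrow> descending_arc C f U (r (\<kappa> z)) (B (\<kappa> z)) (\<Theta> (\<kappa> z)) (M (\<kappa> z)) z \<tau> y u" for z
    using desc[OF ring] by (cases "z \<in> C") auto
  then obtain \<tau> y u where arcs: "\<And>z. z \<notin> C \<Longrightarrow>
      descending_arc C f U (r (\<kappa> z)) (B (\<kappa> z)) (\<Theta> (\<kappa> z)) (M (\<kappa> z)) z (\<tau> z) (y z) (u z)"
    by metis
  obtain a G \<alpha> where G: "K_infinity G" and \<alpha>: "K_infinity \<alpha>" and a: "\<And>k. 0 < a k" "mono a"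
    "\<And>k. a (k - 1) * exp (\<Theta> k) \<le> a k" "\<And>k. B k \<le> G (a (k - 1))"
    "\<And>r. 0 < r \<Longrightarrow> a \<lfloor>log 2 r\<rfloor> \<le> \<alpha> r"
    by (rule K_infinity_rates[OF B_mono B_nonneg B_lim]) (assumption | rule that)+
  obtain \<sigma> where \<sigma>: "continuous_on {0<..} \<sigma>" "\<And>r. 0 < r \<Longrightarrow> 0 < \<sigma> r"
    "\<And>k s. 0 < s \<Longrightarrow> 2 powr real_of_int k / 4 \<le> s \<Longrightarrow> s \<le> B k \<Longrightarrow> M k \<le> \<sigma> s"
    by (rule locally_finite_control_bound[OF B_lim]) (assumption | rule that)+
  have G_mono: "G p \<le> G q" if "0 \<le> p" "p \<le> q" for p q
    using G that unfolding K_infinity_def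
    by (intro mono_onD[OF strict_mono_on_imp_mono_on[of "{0..}" G]]) auto
  have G_nonneg: "0 \<le> G p" if "0 \<le> p" for p
    using G that unfolding K_infinity_def by (meson order_trans)
  have \<alpha>_nonneg: "0 \<le> \<alpha> p" if "0 \<le> p" for p
    using \<alpha> that unfolding K_infinity_def by (meson order_trans)
  have main: "\<exists>T x v. admissible_pair C f U T x v \<and> extended_beyond C T x \<and> x 0 = z0 \<and>
      (\<forall>t\<ge>0. infdist (x t) C \<le> G (\<alpha> (infdist z0 C) * exp (- t))) \<and>
      (AE t in lebesgue_on (time_domain T). norm (v t) \<le> \<sigma> (infdist (x t) C))"
    if z0: "z0 \<notin> C" for z0
  proof -
    define e where "e z = y z (\<tau> z)" for z
    define Z where "Z n = (e ^^ n) z0" for n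
    define k where "k n = \<kappa> (Z n)" for n
    have arcD: "controlled_arc C f U (M (\<kappa> z)) (\<tau> z) (y z) (u z)" "y z 0 = z" "\<tau> z \<le> \<Theta> (\<kappa> z)"
        "\<And>t. t \<in> {0..\<tau> z} \<Longrightarrow> infdist (y z t) C \<in> {r (\<kappa> z)/4..B (\<kappa> z)}" "infdist (e z) C < r (\<kappa> z)"
        "e z \<notin> C" if "z \<notin> C" for z
    proof -
      note arcs[OF that, unfolded descending_arc_def]
      then show 1: "controlled_arc C f U (M (\<kappa> z)) (\<tau> z) (y z) (u z)" "y z 0 = z" "\<tau> z \<le> \<Theta> (\<kappa> z)"
        "\<And>t. t \<in> {0..\<tau> z} \<Longrightarrow> infdist (y z t) C \<in> {r (\<kappa> z)/4..B (\<kappa> z)}" "infdist (e z) C < r (\<kappa> z)"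
        by (auto simp: e_def)
      have "0 < \<tau> z" "\<forall>t\<in>{0..\<tau> z}. y z t \<notin> C" using 1(1) by (simp_all add: controlled_arc_def)
      then show "e z \<notin> C" by (simp add: e_def)
    qed
    have Z0: "Z 0 = z0" and Z_Suc: "Z (Suc n) = e (Z n)" for n by (simp_all add: Z_def)
    have Z_notin: "Z n \<notin> C" for n
      by (induction n) (simp_all add: Z0 Z_Suc z0 arcD(6))
    \<comment> \<open>An arc ends strictly below \<open>2 powr k n\<close>, so the floor of the
      logarithm drops by at least one.\<close>
    have k_step: "k (Suc n) \<le> k n - 1" for n
    proof -
      have "infdist (Z (Suc n)) C < 2 powr k n"
        using arcD(5)[OF Z_notin] by (simp add: Z_Suc k_def r_def)
      then have "log 2 (infdist (Z (Suc n)) C) < k n"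
        using pos[OF Z_notin] by (simp add: log_less_iff)
      then show ?thesis unfolding k_def \<kappa>_def by linarith
    qed
    have k_le: "k n \<le> k 0 - int n" for n
    proof (induction n)
      case (Suc n)
      then show ?case using k_step[of n] by simp
    qed simp
    have k_lim: "filterlim k at_bot sequentially"
      unfolding filterlim_at_bot
    proof
      fix j
      show "\<forall>\<^sub>F n in sequentially. k n \<le> j"
        using k_le by (intro eventually_sequentiallyI[of "nat (k 0 - j)"]) (smt (verit) nat_le_iff)
    qed
    interpret arc_chain C f U "\<lambda>n. M (k n)" "\<lambda>n. \<tau> (Z n)" "\<lambda>n. B (k n)" "\<lambda>n. y (Z n)" "\<lambda>n. u (Z n)"
    proof
      show "controlled_arc C f U (M (k n)) (\<tau> (Z n)) (y (Z n)) (u (Z n))" for n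
        using arcD(1)[OF Z_notin] by (simp add: k_def)
      show "y (Z (Suc n)) 0 = y (Z n) (\<tau> (Z n))" for n
        using arcD(2)[OF Z_notin[of "Suc n"]] by (simp add: Z_Suc e_def)
      show "infdist (y (Z n) t) C \<le> B (k n)" if "t \<in> {0..\<tau> (Z n)}" for n t
        using arcD(4)[OF Z_notin that] by (simp add: k_def)
      show "(\<lambda>n. B (k n)) \<longlonglongrightarrow> 0" by (rule filterlim_compose[OF B_lim k_lim])
    qed (rule C)+
    have step: "a (k n - 1) \<le> a (k n) * exp (- \<tau> (Z n))" for n
    proof -
      have "a (k n - 1) * exp (\<tau> (Z n)) \<le> a (k n - 1) * exp (\<Theta> (k n))"
        using arcD(3)[OF Z_notin[of n]] a(1)[of "k n - 1"] by (intro mult_left_mono) (auto simp: k_def)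
      also have "\<dots> \<le> a (k n)" by (rule a(3))
      finally show ?thesis by (simp add: exp_minus field_simps)
    qed
    \<comment> \<open>The index may drop by more than one per arc; monotonicity of \<open>a\<close>
      absorbs the skipped levels. The exponent contains the end time of the \<open>n\<close>-th arc,
      so the estimate serves at every time during that arc.\<close>
    have decay: "a (k n - 1) \<le> a (k 0) * exp (- S (Suc n))" for n
    proof (induction n)
      case 0
      show ?case using step[of 0] by (simp add: S_Suc)
    next
      case (Suc n)
      have "a (k (Suc n) - 1) \<le> a (k (Suc n)) * exp (- \<tau> (Z (Suc n)))" by (rule step)
      also have "\<dots> \<le> a (k n - 1) * exp (- \<tau> (Z (Suc n)))"
        by (intro mult_right_mono monoD[OF a(2)] k_step) simp
      also have "\<dots> \<le> a (k 0) * exp (- S (Suc n)) * exp (- \<tau> (Z (Suc n)))"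
        by (intro mult_right_mono Suc.IH) simp
      also have "\<dots> = a (k 0) * exp (- S (Suc (Suc n)))"
        by (simp add: S_Suc[of "Suc n"] exp_add[symmetric] mult.assoc)
      finally show ?case .
    qed
    have KL_bound: "infdist (x t) C \<le> G (\<alpha> (infdist z0 C) * exp (- t))" if t: "0 \<le> t" for t
    proof (cases "t \<in> time_domain T")
      case True
      define n where "n = piece t"
      have "infdist (x t) C \<le> B (k n)" using x_infdist_le[OF True] by (simp add: n_def)
      also have "\<dots> \<le> G (a (k n - 1))" by (rule a(4))
      also have "\<dots> \<le> G (\<alpha> (infdist z0 C) * exp (- t))"
      proof (rule G_mono)
        have "a (k n - 1) \<le> a (k 0) * exp (- S (Suc n))" by (rule decay)
        also have "\<dots> \<le> \<alpha> (infdist z0 C) * exp (- t)"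
        proof (rule mult_mono)
          show "a (k 0) \<le> \<alpha> (infdist z0 C)"
            using a(5)[OF pos[OF z0]] by (simp add: k_def \<kappa>_def Z0)
          show "exp (- S (Suc n)) \<le> exp (- t)"
            using piece_bounds(2)[OF True] by (simp add: n_def)
        qed (use \<alpha>_nonneg infdist_nonneg in auto)
        finally show "a (k n - 1) \<le> \<alpha> (infdist z0 C) * exp (- t)" .
      qed (use a(1) in \<open>simp add: less_imp_le\<close>)
      finally show ?thesis .
    next
      \<comment> \<open>From \<open>T\<close> on the trajectory rests at a point of distance
        0.\<close>
      case False
      have "0 \<le> G (\<alpha> (infdist z0 C) * exp (- t))"
        by (intro G_nonneg mult_nonneg_nonneg \<alpha>_nonneg infdist_nonneg) simp
      then show ?thesis using x_outside[OF t False] infdist_zbar by simp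
    qed
    have "AE t in lebesgue_on (time_domain T). norm (v t) \<le> \<sigma> (infdist (x t) C)"
      unfolding AE_lebesgue_on_iff_negligible[OF time_domain_lebesgue]
    proof (rule negligible_subset[OF negligible_bad_control], rule subsetI)
      fix t assume "t \<in> {t \<in> time_domain T. \<not> norm (v t) \<le> \<sigma> (infdist (x t) C)}"
      then have t: "t \<in> time_domain T" "\<not> norm (v t) \<le> \<sigma> (infdist (x t) C)" by auto
      define n where "n = piece t"
      \<comment> \<open>The distance lies in the range where \<open>\<sigma>\<close> dominates
        \<open>M (k n)\<close>, and the control exceeds \<open>M (k n)\<close> on a null set
        only.\<close>
      have "infdist (x t) C \<in> {r (k n)/4..B (k n)}"
        using arcD(4)[OF Z_notin piece_time[OF t(1)]] x_in[OF t(1)] by (simp add: n_def k_def)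
      then have "r (k n) / 4 \<le> infdist (x t) C" "infdist (x t) C \<le> B (k n)" by auto
      moreover from this have "0 < infdist (x t) C" using r_pos[of "k n"] by linarith
      ultimately have "M (k n) \<le> \<sigma> (infdist (x t) C)"
        by (intro \<sigma>(3)) (simp_all add: r_def)
      with t show "t \<in> {t \<in> time_domain T. \<not> (v t \<in> U \<and> norm (v t) \<le> M (k (piece t)))}"
        by (auto simp: n_def)
    qed
    moreover have "x 0 = z0" using x_S[of 0] arcD(2)[OF Z_notin[of 0]] by (simp add: Z0)
    ultimately show ?thesis
      using admissible extended KL_bound by blast
  qed
  have "GAC_controls C f U \<sigma>"
    unfolding GAC_controls_def
    using KL_function_K_infinity_exp[OF G \<alpha>] main by (intro exI[of _ "\<lambda>r t. G (\<alpha> r * exp (- t))"]) blast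
  with \<sigma>(1,2) show ?thesis by blast
qed

theorem theorem2p5:
  fixes C :: "(real ^ 'n) set" and U :: "(real ^ 'm) set"
    and f :: "real ^ 'n \<Rightarrow> real ^ 'm \<Rightarrow> real ^ 'n"
  assumes "C \<noteq> {}" and "closed C" and "compact (frontier C)"
    and "closed U" and "cone U"
    and "continuous_on ((- C) \<times> U) (\<lambda>(x, u). f x u)"
    and "\<And>K U1. compact K \<Longrightarrow> K \<subseteq> - C \<Longrightarrow> compact U1 \<Longrightarrow> U1 \<subseteq> U \<Longrightarrow>
           \<exists>L>0. \<forall>x\<in>K. \<forall>y\<in>K. \<forall>u\<in>U1. norm (f x u - f y u) \<le> L * norm (x - y)"
  shows "GAC C f U \<longleftrightarrow>
    (\<exists>\<sigma>::real \<Rightarrow> real. continuous_on {0<..} \<sigma> \<and> (\<forall>r>0. \<sigma> r > 0) \<and> GAC_controls C f U \<sigma>)"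
proof
  assume "GAC C f U"
  then show "\<exists>\<sigma>::real \<Rightarrow> real. continuous_on {0<..} \<sigma> \<and> (\<forall>r>0. \<sigma> r > 0) \<and> GAC_controls C f U \<sigma>"
    using GAC_imp_GAC_controls[OF assms(2,1,3,4,6,7)] by blast
next
  assume "\<exists>\<sigma>::real \<Rightarrow> real. continuous_on {0<..} \<sigma> \<and> (\<forall>r>0. \<sigma> r > 0) \<and> GAC_controls C f U \<sigma>"
  then show "GAC C f U"
    unfolding GAC_controls_def GAC_def by meson
qed

end
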